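(* Let $\varepsilon>0$ and $B_0>0$, let $f\in C([0,T];H)$ and $\Phi\in H$, and let $u$ be a solution of the backward problem $$\sum_{j=1}^{M} q_j\,\partial_t^{\rho_j}u(t)+Au(t)=f(t),\quad 0<t<T,\qquad u(T)=\Phi,$$ whose initial value $\varphi=u(0)$ belongs to $D(A^{\varepsilon})$ and satisfies $$\|\varphi\|_{\varepsilon}^{2}=\sum_{k=1}^{\infty}\lambda_k^{2\varepsilon}|(\varphi,v_k)|^{2}\le B_0^{2}.$$ Then there is a constant $C$, depending on $T$, $\varepsilon$ and $\rho_1$, such that $$\|\varphi\|\le C\Big[\|\Phi\|+\max_{t\in[0,T]}\|f(t)\|\Big]^{\frac{\varepsilon}{1+\varepsilon}}B_0^{\frac{1}{1+\varepsilon}}.$$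
   Context: $H$ is a separable Hilbert space with inner product $(\cdot,\cdot)$ and norm $\|\cdot\|$. $A$ is a positive self-adjoint operator in $H$ with domain $D(A)$ and compact inverse $A^{-1}$. Hence $A$ has a complete orthonormal system of eigenfunctions $\{v_k\}_{k\ge1}$ with eigenvalues $0<\lambda_1\le\lambda_2\le\cdots\to+\infty$. For $g\in H$ put $g_k=(g,v_k)$. For real $\varepsilon$: $D(A^{\varepsilon})=\{g\in H:\sum_{k=1}^\infty\lambda_k^{2\varepsilon}|g_k|^2<\infty\}$, $A^{\varepsilon}g=\sum_{k=1}^\infty\lambda_k^{\varepsilon}g_kv_k$, and $\|g\|_{\varepsilon}=\|A^{\varepsilon}g\|$. $T>0$, $M\ge1$ is an integer, $0<\rho_M<\rho_{M-1}<\cdots<\rho_1<1$, $q_j>0$ for $j=1,\dots,M$, and $q_1=1$. The Caputo derivative of order $\rho_j$ is $$\partial_t^{\rho_j}h(t)=\frac{1}{\Gamma(1-\rho_j)}\int_0^t\frac{h'(s)}{(t-s)^{\rho_j}}\,ds,\quad t>0,$$ provided the right-hand side exists. The data $H$, $A$, $M$, $\rho_j$, $q_j$, $T$ are fixed; the constant $C$ does not depend on $\varphi$, $\Phi$, $f$, $u$ or $B_0$. A solution is a function $u\in C([0,T];H)$ such that for $0<t<T$ one has $u(t)\in D(A)$, the derivatives $\partial_t^{\rho_j}u(t)$ exist in $H$, and the equation holds in $H$, and such that the final condition $u(T)=\Phi$ holds. *)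

theory Defs
  imports "HOL-Analysis.Analysis"
begin

text \<open>
  The separable Hilbert space is a type of class
  \<open>{real_inner, banach, second_countable_topology}\<close>; for a metric space, second countability is
  separability. A complex Hilbert space is covered through its underlying real one, with the real
  part of its inner product.

  An unbounded operator is a domain \<open>D\<close> together with a function \<open>A\<close> whose values
  outside \<open>D\<close> are irrelevant.
\<close>

definition linear_operator :: "'h::real_inner set \<Rightarrow> ('h \<Rightarrow> 'h) \<Rightarrow> bool" where
  "linear_operator D A \<longleftrightarrow> subspace D \<and>
     (\<forall>x\<in>D. \<forall>y\<in>D. A (x + y) = A x + A y) \<and> (\<forall>c. \<forall>x\<in>D. A (c *\<^sub>R x) = c *\<^sub>R A x)"

definition operator_graph :: "'h set \<Rightarrow> ('h \<Rightarrow> 'h) \<Rightarrow> ('h \<times> 'h) set" where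
  "operator_graph D A = {(x, A x) |x. x \<in> D}"

definition adjoint_graph :: "'h::real_inner set \<Rightarrow> ('h \<Rightarrow> 'h) \<Rightarrow> ('h \<times> 'h) set" where
  "adjoint_graph D A = {(y, z). \<forall>x\<in>D. inner (A x) y = inner x z}"

text \<open>Equality of the graphs includes equality of the domains of the operator and its adjoint.\<close>

definition self_adjoint :: "'h::real_inner set \<Rightarrow> ('h \<Rightarrow> 'h) \<Rightarrow> bool" where
  "self_adjoint D A \<longleftrightarrow> linear_operator D A \<and> closure D = UNIV \<and>
     adjoint_graph D A = operator_graph D A"

definition positive_operator :: "'h::real_inner set \<Rightarrow> ('h \<Rightarrow> 'h) \<Rightarrow> bool" where
  "positive_operator D A \<longleftrightarrow> (\<forall>x\<in>D. x \<noteq> 0 \<longrightarrow> 0 < inner (A x) x)"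

definition compact_operator :: "('h::real_normed_vector \<Rightarrow> 'h) \<Rightarrow> bool" where
  "compact_operator K \<longleftrightarrow> linear K \<and> (\<forall>S. bounded S \<longrightarrow> compact (closure (K ` S)))"

definition has_compact_inverse :: "'h::real_normed_vector set \<Rightarrow> ('h \<Rightarrow> 'h) \<Rightarrow> bool" where
  "has_compact_inverse D A \<longleftrightarrow> bij_betw A D UNIV \<and> compact_operator (inv_into D A)"

text \<open>The eigenpairs are numbered from \<open>0\<close>: \<open>v k\<close> and \<open>lam k\<close> are the \<open>(k + 1)\<close>-st
  eigenfunction and eigenvalue.\<close>

definition eigensystem ::
    "'h::real_inner set \<Rightarrow> ('h \<Rightarrow> 'h) \<Rightarrow> (nat \<Rightarrow> 'h) \<Rightarrow> (nat \<Rightarrow> real) \<Rightarrow> bool" where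
  "eigensystem D A v lam \<longleftrightarrow>
     (\<forall>i j. inner (v i) (v j) = (if i = j then 1 else 0)) \<and>
     closure (span (range v)) = UNIV \<and>
     (\<forall>k. v k \<in> D \<and> A (v k) = lam k *\<^sub>R v k) \<and>
     0 < lam 0 \<and> incseq lam \<and> filterlim lam at_top sequentially"

definition power_domain :: "(nat \<Rightarrow> 'h::real_inner) \<Rightarrow> (nat \<Rightarrow> real) \<Rightarrow> real \<Rightarrow> 'h set" where
  "power_domain v lam \<epsilon> = {g. summable (\<lambda>k. lam k powr (2 * \<epsilon>) * \<bar>inner g (v k)\<bar>\<^sup>2)}"

definition operator_power :: "(nat \<Rightarrow> 'h::real_inner) \<Rightarrow> (nat \<Rightarrow> real) \<Rightarrow> real \<Rightarrow> 'h \<Rightarrow> 'h" where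
  "operator_power v lam \<epsilon> g = (\<Sum>k. (lam k powr \<epsilon> * inner g (v k)) *\<^sub>R v k)"

definition power_norm :: "(nat \<Rightarrow> 'h::real_inner) \<Rightarrow> (nat \<Rightarrow> real) \<Rightarrow> real \<Rightarrow> 'h \<Rightarrow> real" where
  "power_norm v lam \<epsilon> g = norm (operator_power v lam \<epsilon> g)"

text \<open>The right-hand side of the Caputo formula exists when \<open>h\<close> is (strongly) differentiable at
  every point of \<open>(0, t)\<close> and the integral converges as a Bochner integral. Differentiability
  merely almost everywhere would admit singular functions, whose derivative does not determine
  their increments.\<close>

definition caputo_exists ::
    "real \<Rightarrow> (real \<Rightarrow> 'h::{banach, second_countable_topology}) \<Rightarrow> real \<Rightarrow> bool" where
  "caputo_exists r h t \<longleftrightarrow> (\<forall>s\<in>{0<..<t}. h differentiable (at s)) \<and>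
     set_integrable lborel {0<..<t} (\<lambda>s. (1 / (t - s) powr r) *\<^sub>R vector_derivative h (at s))"

definition caputo ::
    "real \<Rightarrow> (real \<Rightarrow> 'h::{banach, second_countable_topology}) \<Rightarrow> real \<Rightarrow> 'h" where
  "caputo r h t = (1 / Gamma (1 - r)) *\<^sub>R
     (LINT s:{0<..<t}|lborel. (1 / (t - s) powr r) *\<^sub>R vector_derivative h (at s))"

definition admissible_coefficients :: "nat \<Rightarrow> (nat \<Rightarrow> real) \<Rightarrow> (nat \<Rightarrow> real) \<Rightarrow> bool" where
  "admissible_coefficients M \<rho> q \<longleftrightarrow> 1 \<le> M \<and>
     0 < \<rho> M \<and> strict_antimono_on {1..M} \<rho> \<and> \<rho> 1 < 1 \<and>
     (\<forall>j\<in>{1..M}. 0 < q j) \<and> q 1 = 1"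

definition backward_solution ::
    "'h::{real_inner, banach, second_countable_topology} set \<Rightarrow> ('h \<Rightarrow> 'h) \<Rightarrow> nat \<Rightarrow>
     (nat \<Rightarrow> real) \<Rightarrow> (nat \<Rightarrow> real) \<Rightarrow> real \<Rightarrow> (real \<Rightarrow> 'h) \<Rightarrow> 'h \<Rightarrow> (real \<Rightarrow> 'h) \<Rightarrow> bool" where
  "backward_solution D A M \<rho> q T f \<Phi> u \<longleftrightarrow>
     continuous_on {0..T} u \<and>
     (\<forall>t\<in>{0<..<T}. u t \<in> D \<and> (\<forall>j\<in>{1..M}. caputo_exists (\<rho> j) u t) \<and>
        (\<Sum>j=1..M. q j *\<^sub>R caputo (\<rho> j) u t) + A (u t) = f t) \<and>
     u T = \<Phi>"

end

theory Submission
  imports Defs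
begin

text \<open>Expand everything in the eigenbasis. Write \<open>\<phi>\<^sub>k\<close>, \<open>u\<^sub>k\<close>, \<open>f\<^sub>k\<close> for the coefficients of
\<open>u 0\<close>, \<open>u\<close>, \<open>f\<close>, and \<open>P\<close> for the multi-term derivative \<open>\<Sum>\<^sub>j q\<^sub>j \<partial>\<^bsup>\<rho>\<^sub>j\<^esup>\<close>. Self-adjointness turns the
equation into the scalar equations \<open>P u\<^sub>k + \<lambda>\<^sub>k u\<^sub>k = f\<^sub>k\<close> (\<open>modal_equation\<close>). If \<open>E\<^sub>k\<close> is the
relaxation function, \<open>P E\<^sub>k + \<lambda>\<^sub>k E\<^sub>k = 0\<close> and \<open>E\<^sub>k(0) = 1\<close>, then \<open>u\<^sub>k = \<phi>\<^sub>k E\<^sub>k + w\<^sub>k\<close>, where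
\<open>w\<^sub>k\<close> vanishes at \<open>0\<close> and is driven by \<open>f\<^sub>k\<close>. Two estimates then control \<open>\<phi>\<close>.

The first is a lower bound for \<open>E\<^sub>k\<close>. If \<open>h\<close> attains its maximum over \<open>[0,t]\<close> at \<open>t\<close>, then
integration by parts in the Caputo integral gives \<open>P h(t) \<ge> \<kappa>(t) (h(t) - h(0))\<close>, where
\<open>\<kappa>(t) = 1 / (\<Gamma>(1 - \<rho>\<^sub>1) t\<^bsup>\<rho>\<^sub>1\<^esup>)\<close> comes from the term of order \<open>\<rho>\<^sub>1\<close> alone, whose coefficient is
\<open>1\<close> (\<open>multi_caputo_ge_at_max\<close>). This is why the constant sees neither the lower orders nor
their coefficients. Applied at a minimum of \<open>E\<^sub>k\<close> it gives \<open>E\<^sub>k(t) \<ge> \<kappa>(t) / (\<kappa>(t) + \<lambda>\<^sub>k)\<close>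
(\<open>relaxation_lower_bound\<close>), so the passage from \<open>\<phi>\<close> to \<open>u(T)\<close> loses no more than one power of
\<open>\<lambda>\<^sub>k\<close>.

The second bounds all the \<open>w\<^sub>k\<close> at once. Estimating each mode separately would leave
\<open>\<Sum>\<^sub>k (sup\<^sub>t \<bar>f\<^sub>k(t)\<bar>)\<^sup>2\<close>, which \<open>sup\<^sub>t \<parallel>f(t)\<parallel>\<close> does not control. At a time \<open>t\<^sub>0\<close> where
\<open>\<Sum>\<^sub>k w\<^sub>k\<^sup>2\<close> is maximal, the maximum estimate is applied to \<open>s \<mapsto> \<Sum>\<^sub>k w\<^sub>k(t\<^sub>0) w\<^sub>k(s)\<close> instead, and
yields \<open>\<parallel>w\<parallel> \<le> max \<parallel>f\<parallel> / \<lambda>\<close> with the smallest eigenvalue \<open>\<lambda>\<close> (\<open>forced_system_bound\<close>).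

Together these give \<open>\<parallel>A\<^sup>-\<^sup>1 \<phi>\<parallel> \<le> K (\<parallel>\<Phi>\<parallel> + max \<parallel>f\<parallel>)\<close>, and interpolating between this bound and
\<open>\<parallel>A\<^bsup>\<epsilon>\<^esup> \<phi>\<parallel> \<le> B\<^sub>0\<close> by the Hoelder inequality (\<open>power_scale_interpolation\<close>) is the assertion.

In place of the exact \<open>E\<^sub>k\<close> the proof uses partial sums of its Volterra series. They are
finite combinations of powers of \<open>t\<close> with explicit Caputo derivatives, and they solve the
relaxation equation up to a uniformly small residual (\<open>approximate_relaxation_function\<close>). The
residual is one more forcing term and disappears in the limit. Since the equation is given only for
\<open>t < T\<close>, the estimates are made at times \<open>\<tau> < T\<close>, with constants that are
uniform as \<open>\<tau>\<close> tends to \<open>T\<close>.\<close>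

section \<open>Caputo derivatives\<close>

definition has_caputo ::
    "real \<Rightarrow> (real \<Rightarrow> 'h::{banach, second_countable_topology}) \<Rightarrow> real \<Rightarrow> 'h \<Rightarrow> bool" where
  "has_caputo r h t y \<longleftrightarrow> caputo_exists r h t \<and> caputo r h t = y"

lemma has_caputo_lin:
  assumes h: "has_caputo r h t y"
    and bl: "bounded_linear L"
  shows "has_caputo r (\<lambda>s. L (h s)) t (L y)"
proof -
  have d: "h differentiable (at s)" if "s \<in> {0<..<t}" for s
    using h that by (auto simp: has_caputo_def caputo_exists_def)
  have hv: "(h has_vector_derivative vector_derivative h (at s)) (at s)" if "s \<in> {0<..<t}" for s
    using d[OF that] by (simp add: vector_derivative_works)
  have Lv: "((\<lambda>s. L (h s)) has_vector_derivative L (vector_derivative h (at s))) (at s)"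
    if "s \<in> {0<..<t}" for s
    using bounded_linear.has_vector_derivative[OF bl hv[OF that]] .
  have vd: "vector_derivative (\<lambda>s. L (h s)) (at s) = L (vector_derivative h (at s))"
    if "s \<in> {0<..<t}" for s
    using Lv[OF that] by (rule vector_derivative_at)
  interpret bounded_linear L by fact
  have eq: "indicator {0<..<t} s *\<^sub>R ((1 / (t - s) powr r) *\<^sub>R vector_derivative (\<lambda>s. L (h s)) (at s))
     = L (indicator {0<..<t} s *\<^sub>R ((1 / (t - s) powr r) *\<^sub>R vector_derivative h (at s)))" for s
    by (auto simp: indicator_def vd scaleR)
  have I: "integrable lborel (\<lambda>s. indicator {0<..<t} s *\<^sub>R ((1 / (t - s) powr r) *\<^sub>R vector_derivative h (at s)))"
    using h by (auto simp: has_caputo_def caputo_exists_def set_integrable_def)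
  have "caputo_exists r (\<lambda>s. L (h s)) t"
    unfolding caputo_exists_def set_integrable_def eq
    using integrable_bounded_linear[OF bl I] differentiableI_vector[OF Lv] by blast
  moreover have "caputo r (\<lambda>s. L (h s)) t = L y"
    using h integral_bounded_linear[OF bl I] unfolding has_caputo_def caputo_def set_lebesgue_integral_def eq
    by (auto simp: scaleR)
  ultimately show ?thesis by (simp add: has_caputo_def)
qed

lemma has_caputo_add:
  assumes h: "has_caputo r h t y" and g: "has_caputo r g t z"
  shows "has_caputo r (\<lambda>s. h s + g s) t (y + z)"
proof -
  have hv: "(h has_vector_derivative vector_derivative h (at s)) (at s)"
           "(g has_vector_derivative vector_derivative g (at s)) (at s)" if "s \<in> {0<..<t}" for s
    using h g that by (auto simp: has_caputo_def caputo_exists_def vector_derivative_works)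
  have Lv: "((\<lambda>s. h s + g s) has_vector_derivative vector_derivative h (at s) + vector_derivative g (at s)) (at s)"
    if "s \<in> {0<..<t}" for s
    using hv[OF that] by (rule has_vector_derivative_add)
  have vd: "vector_derivative (\<lambda>s. h s + g s) (at s) = vector_derivative h (at s) + vector_derivative g (at s)"
    if "s \<in> {0<..<t}" for s
    using Lv[OF that] by (rule vector_derivative_at)
  have eq: "indicator {0<..<t} s *\<^sub>R ((1 / (t - s) powr r) *\<^sub>R vector_derivative (\<lambda>s. h s + g s) (at s))
     = indicator {0<..<t} s *\<^sub>R ((1 / (t - s) powr r) *\<^sub>R vector_derivative h (at s))
     + indicator {0<..<t} s *\<^sub>R ((1 / (t - s) powr r) *\<^sub>R vector_derivative g (at s))" for s
    by (auto simp: indicator_def vd scaleR_add_right)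
  have I: "integrable lborel (\<lambda>s. indicator {0<..<t} s *\<^sub>R ((1 / (t - s) powr r) *\<^sub>R vector_derivative h (at s)))"
     "integrable lborel (\<lambda>s. indicator {0<..<t} s *\<^sub>R ((1 / (t - s) powr r) *\<^sub>R vector_derivative g (at s)))"
    using h g by (auto simp: has_caputo_def caputo_exists_def set_integrable_def)
  have "caputo_exists r (\<lambda>s. h s + g s) t"
    unfolding caputo_exists_def set_integrable_def eq
    using Bochner_Integration.integrable_add[OF I] differentiableI_vector[OF Lv] by blast
  moreover have "caputo r (\<lambda>s. h s + g s) t = y + z"
    using h g Bochner_Integration.integral_add[OF I] unfolding has_caputo_def caputo_def set_lebesgue_integral_def eq
    by (auto simp: scaleR_add_right)
  ultimately show ?thesis by (simp add: has_caputo_def)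
qed

lemma has_caputo_const: "has_caputo r (\<lambda>s. c) t 0"
  by (auto simp: has_caputo_def caputo_exists_def caputo_def set_integrable_def set_lebesgue_integral_def)

lemma has_caputo_scale: "has_caputo r h t y \<Longrightarrow> has_caputo r (\<lambda>s. c *\<^sub>R h s) t (c *\<^sub>R y)"
  by (rule has_caputo_lin[OF _ bounded_linear_scaleR_right])

lemma has_caputo_sum:
  "(\<And>i. i \<in> I \<Longrightarrow> has_caputo r (h i) t (y i)) \<Longrightarrow> has_caputo r (\<lambda>s. \<Sum>i\<in>I. h i s) t (\<Sum>i\<in>I. y i)"
proof (induction I rule: infinite_finite_induct)
  case (insert i I)
  then show ?case by (auto intro: has_caputo_add)
qed (simp_all add: has_caputo_const)

text \<open>Formally \<open>\<integral>\<^sub>0\<^sup>t (t - s)\<^bsup>-r\<^esup> h'(s) ds = t\<^bsup>-r\<^esup> (h t - h 0) + r \<integral>\<^sub>0\<^sup>t (t - s)\<^bsup>-r-1\<^esup> (h t - h s) ds\<close>, and the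
last integral is nonnegative. The proof applies the fundamental theorem of calculus to
\<open>(t - s)\<^bsup>-r\<^esup> (h s - h t)\<close>, whose derivative lies below the Caputo integrand, so that the last
integral need not be known to converge.\<close>

lemma caputo_ge_at_max:
  fixes h :: "real \<Rightarrow> real"
  assumes c: "has_caputo r h t y" and cont: "continuous_on {0..t} h"
    and t: "0 < t" and r: "0 < r" "r < 1"
    and max: "\<And>s. s \<in> {0..t} \<Longrightarrow> h s \<le> h t"
  shows "(h t - h 0) / (Gamma (1 - r) * t powr r) \<le> y"
proof -
  define h' where "h' s = vector_derivative h (at s)" for s
  define g where "g s = (1 / (t - s) powr r) * h' s" for s
  have si: "set_integrable lborel {0<..<t} g"
    using c by (auto simp: has_caputo_def caputo_exists_def g_def[abs_def] h'_def[abs_def])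
  have hv: "(h has_vector_derivative h' s) (at s)" if "s \<in> {0<..<t}" for s
    using c that by (auto simp: has_caputo_def caputo_exists_def vector_derivative_works h'_def)
  have y: "y = integral {0<..<t} g / Gamma (1 - r)"
    using c set_borel_integral_eq_integral(2)[OF si]
    by (simp add: has_caputo_def caputo_def g_def[abs_def] h'_def)
  have agi: "(\<lambda>s. \<bar>g s\<bar>) integrable_on {0..t}"
    using set_borel_integral_eq_integral(1)[OF set_integrable_abs[OF si]] by (simp add: integrable_on_Icc_iff_Ioo)
  have Gamma: "Gamma (1 - r) > 0" using r by (simp add: Gamma_real_pos)
  define K where "K s = (h s - h t) / (t - s) powr r" for s
  define B where "B s = integral {s..t} (\<lambda>s. \<bar>g s\<bar>)" for s
  \<comment> \<open>On \<open>(s, t)\<close> the weight \<open>(t - x) powr r\<close> is at most \<open>(t - s) powr r\<close>. The increment of \<open>h\<close> is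
    therefore absorbed by the tail of the Caputo integral, which makes \<open>K\<close> continuous at \<open>t\<close>.\<close>
  have KB: "\<bar>K s\<bar> \<le> B s" if s: "s \<in> {0..<t}" for s
  proof -
    have "(h' has_integral (h t - h s)) {s..t}"
      using s by (intro fundamental_theorem_of_calculus_interior continuous_on_subset[OF cont] hv) auto
    then have 1: "(h' has_integral (h t - h s)) {s<..<t}"
      by (simp add: has_integral_Icc_iff_Ioo)
    have "(\<lambda>s. \<bar>g s\<bar>) integrable_on {s..t}"
      using s by (intro integrable_on_subinterval[OF agi]) auto
    then have 2: "(\<lambda>x. (t - s) powr r * \<bar>g x\<bar>) integrable_on {s<..<t}"
      using integrable_cmul[of "\<lambda>s. \<bar>g s\<bar>" "{s<..<t}" "(t - s) powr r"]
      by (simp add: integrable_on_Icc_iff_Ioo)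
    have "norm (integral {s<..<t} h') \<le> integral {s<..<t} (\<lambda>x. (t - s) powr r * \<bar>g x\<bar>)"
    proof (rule integral_norm_bound_integral)
      show "h' integrable_on {s<..<t}" using 1 by blast
      show "(\<lambda>x. (t - s) powr r * \<bar>g x\<bar>) integrable_on {s<..<t}" by (rule 2)
      fix x assume x: "x \<in> {s<..<t}"
      have "(t - x) powr r \<le> (t - s) powr r"
        using x r by (intro powr_mono2) auto
      then have "(t - x) powr r * \<bar>g x\<bar> \<le> (t - s) powr r * \<bar>g x\<bar>" by (intro mult_right_mono) auto
      moreover have "(t - x) powr r * \<bar>g x\<bar> = \<bar>h' x\<bar>"
        using x by (simp add: g_def abs_mult)
      ultimately show "norm (h' x) \<le> (t - s) powr r * \<bar>g x\<bar>" by simp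
    qed
    also have "\<dots> = (t - s) powr r * B s"
      by (simp add: B_def integral_open_interval_real)
    also have "integral {s<..<t} h' = h t - h s" using 1 by blast
    finally show ?thesis using s by (simp add: K_def field_simps)
  qed
  have contK: "continuous_on {0..t} K"
  proof -
    have "continuous (at s within {0..t}) K" if s: "s \<in> {0..t}" for s
    proof (cases "s = t")
      case False
      have "continuous (at s within {0..t}) h" using cont s by (simp add: continuous_on_eq_continuous_within)
      then show ?thesis unfolding K_def using s False
        by (intro continuous_intros) auto
    next
      case True
      have "continuous_on {0..t} B" unfolding B_def by (rule indefinite_integral_continuous_1'[OF agi])
      then have "(B \<longlongrightarrow> B t) (at t within {0..t})" using t by (simp add: continuous_on_def)
      then have "(B \<longlongrightarrow> 0) (at t within {0..t})" by (simp add: B_def)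
      moreover have "\<forall>\<^sub>F s in at t within {0..t}. norm (K s) \<le> B s"
        using KB by (auto simp: eventually_at_filter intro!: always_eventually)
      ultimately have "(K \<longlongrightarrow> 0) (at t within {0..t})"
        by (rule Lim_null_comparison[rotated])
      then show ?thesis using True by (simp add: continuous_within K_def)
    qed
    then show ?thesis by (simp add: continuous_on_eq_continuous_within)
  qed
  define k' where "k' s = g s + r * (h s - h t) * (t - s) powr (- r - 1)" for s
  have derK: "(K has_vector_derivative k' s) (at s)" if s: "s \<in> {0<..<t}" for s
  proof -
    have h: "(h has_real_derivative h' s) (at s)"
      using hv[OF s] by (simp add: has_real_derivative_iff_has_vector_derivative)
    have "((\<lambda>s. (h s - h t) * (t - s) powr (- r)) has_real_derivative k' s) (at s)"
      unfolding k'_def g_def using s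
      by (auto intro!: derivative_eq_intros h simp: field_simps powr_minus powr_diff)
    then show ?thesis
      by (simp add: K_def[abs_def] has_real_derivative_iff_has_vector_derivative powr_minus divide_inverse)
  qed
  have "(k' has_integral (K t - K 0)) {0..t}"
    using t by (intro fundamental_theorem_of_calculus_interior contK derK) auto
  then have k'i: "(k' has_integral (h t - h 0) / t powr r) {0<..<t}"
    by (simp add: K_def has_integral_Icc_iff_Ioo diff_divide_distrib)
  have "(h t - h 0) / t powr r \<le> integral {0<..<t} g"
  proof (rule has_integral_le[OF k'i])
    show "(g has_integral integral {0<..<t} g) {0<..<t}"
      using set_borel_integral_eq_integral(1)[OF si] by (rule integrable_integral)
    fix x assume x: "x \<in> {0<..<t}"
    \<comment> \<open>The only use of maximality at \<open>t\<close>.\<close>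
    have "r * (h x - h t) * (t - x) powr (- r - 1) \<le> 0"
      using max[of x] x r by (intro mult_nonpos_nonneg mult_nonneg_nonpos) auto
    then show "k' x \<le> g x" by (simp add: k'_def)
  qed
  then have "(h t - h 0) / t powr r / Gamma (1 - r) \<le> y"
    unfolding y using Gamma by (intro divide_right_mono) auto
  then show ?thesis by (simp add: mult.commute)
qed

text \<open>Substituting \<open>s = t x\<close> turns the Caputo integral of \<open>s powr \<gamma>\<close> into the Beta integral
\<open>Beta \<gamma> (1 - r)\<close>. The normalisation by \<open>Gamma (\<gamma> + 1)\<close> makes the derivative a pure shift of the
exponent, including the case \<open>\<gamma> = r\<close>, where it is the constant \<open>1\<close>.\<close>

lemma has_caputo_powr:
  assumes t: "0 < t" and g: "0 < \<gamma>" and r: "0 < r" "r < 1"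
  shows "has_caputo r (\<lambda>s. s powr \<gamma> / Gamma (\<gamma> + 1)) t (t powr (\<gamma> - r) / Gamma (\<gamma> - r + 1))"
proof -
  let ?m = "\<lambda>s. s powr \<gamma> / Gamma (\<gamma> + 1) :: real"
  have G: "Gamma (\<gamma> + 1) > 0" "Gamma \<gamma> > 0" "Gamma (1 - r) > 0" "Gamma (\<gamma> - r + 1) > 0"
    using g r by auto
  have G1: "Gamma (\<gamma> + 1) = \<gamma> * Gamma \<gamma>" using g by (intro Gamma_plus1) auto
  have der: "(?m has_vector_derivative (s powr (\<gamma> - 1) / Gamma \<gamma>)) (at s)" if "s > 0" for s
  proof -
    have "(?m has_real_derivative (\<gamma> * s powr (\<gamma> - 1) / Gamma (\<gamma> + 1))) (at s)"
      by (rule DERIV_cdivide[OF has_real_derivative_powr[OF that]])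
    moreover have "\<gamma> * s powr (\<gamma> - 1) / Gamma (\<gamma> + 1) = s powr (\<gamma> - 1) / Gamma \<gamma>"
      unfolding G1 by (rule mult_divide_mult_cancel_left) (use g in simp)
    ultimately show ?thesis
      by (simp only: has_real_derivative_iff_has_vector_derivative)
  qed
  define F :: "real \<Rightarrow> real" where "F x = indicator {0<..<1::real} x *\<^sub>R (x powr (\<gamma> - 1) * (1 - x) powr ((1 - r) - 1))" for x
  have si: "set_integrable lborel {0<..<1} (\<lambda>x. x powr (\<gamma> - 1) * (1 - x) powr ((1 - r) - 1))"
    by (rule set_integrable_subset[OF integrable_Beta[of \<gamma> "1 - r"]]) (use g r in auto)
  have Fi: "integrable lborel F" using si by (simp add: F_def[abs_def] set_integrable_def)
  have FI: "integral\<^sup>L lborel F = Beta \<gamma> (1 - r)"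
  proof -
    have "integral\<^sup>L lborel F = integral {0<..<1} (\<lambda>x. x powr (\<gamma> - 1) * (1 - x) powr ((1 - r) - 1))"
      using set_borel_integral_eq_integral(2)[OF si] by (simp add: F_def[abs_def] set_lebesgue_integral_def)
    also have "\<dots> = Beta \<gamma> (1 - r)"
      using has_integral_Beta_real[of \<gamma> "1 - r"] g r
      by (simp add: has_integral_Icc_iff_Ioo integral_unique)
    finally show ?thesis .
  qed
  let ?J = "\<lambda>s. indicator {0<..<t} s *\<^sub>R ((1 / (t - s) powr r) *\<^sub>R vector_derivative ?m (at s))"
  have eq: "?J s = (t powr (\<gamma> - 1 - r) / Gamma \<gamma>) * F (0 + (1 / t) * s)" for s
  proof (cases "s \<in> {0<..<t}")
    case True
    then have 1: "vector_derivative ?m (at s) = s powr (\<gamma> - 1) / Gamma \<gamma>"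
      by (intro vector_derivative_at der) auto
    have p: "t powr (1 + r) = t * t powr r" using t by (simp add: powr_add)
    have 2: "1 - s / t = (t - s) / t" using t by (simp add: field_simps)
    have "s / t < 1" "s / t > 0" using True by auto
    then have "F (0 + (1 / t) * s) = (s / t) powr (\<gamma> - 1) * ((t - s) / t) powr (- r)"
      by (simp add: F_def 2)
    also have "\<dots> = s powr (\<gamma> - 1) / (t - s) powr r / t powr (\<gamma> - 1 - r)"
      using True p by (simp add: powr_divide powr_minus powr_diff field_simps)
    finally show ?thesis using True t by (simp add: 1)
  next
    case False
    then have "\<not> (0 < s / t \<and> s / t < 1)" using t by (simp add: zero_less_divide_iff)
    then show ?thesis using False by (simp add: F_def)
  qed
  have "integrable lborel (\<lambda>x. F (0 + (1 / t) * x))"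
    using t by (intro lborel_integrable_real_affine Fi) auto
  then have Ji: "integrable lborel ?J" unfolding eq by auto
  have "(LINT x|lborel. F (0 + (1 / t) * x)) = t * Beta \<gamma> (1 - r)"
    using lborel_integral_real_affine[of "1/t" F 0] t by (simp add: FI field_simps)
  then have JI: "integral\<^sup>L lborel ?J = (t powr (\<gamma> - 1 - r) / Gamma \<gamma>) * (t * Beta \<gamma> (1 - r))"
    unfolding eq by simp
  have "caputo r ?m t = t powr (\<gamma> - 1 - r) * t / Gamma (\<gamma> - r + 1)"
    using G unfolding caputo_def set_lebesgue_integral_def JI
    by (simp add: Beta_def field_simps)
  also have "t powr (\<gamma> - 1 - r) * t = t powr (\<gamma> - r)"
    using t powr_add[of t "\<gamma> - 1 - r" 1] by simp
  finally have "caputo r ?m t = t powr (\<gamma> - r) / Gamma (\<gamma> - r + 1)" .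
  moreover have "caputo_exists r ?m t"
    unfolding caputo_exists_def set_integrable_def using Ji differentiableI_vector[OF der]
    by (metis greaterThanLessThan_iff)
  ultimately show ?thesis by (simp add: has_caputo_def)
qed

section \<open>Multi-term derivatives\<close>

definition has_multi_caputo :: "nat \<Rightarrow> (nat \<Rightarrow> real) \<Rightarrow> (nat \<Rightarrow> real) \<Rightarrow>
    (real \<Rightarrow> 'h::{banach, second_countable_topology}) \<Rightarrow> real \<Rightarrow> 'h \<Rightarrow> bool" where
  "has_multi_caputo M \<rho> q h t y \<longleftrightarrow>
     (\<exists>z. (\<forall>j\<in>{1..M}. has_caputo (\<rho> j) h t (z j)) \<and> y = (\<Sum>j=1..M. q j *\<^sub>R z j))"

lemma has_multi_caputoI:
  "(\<And>j. j \<in> {1..M} \<Longrightarrow> has_caputo (\<rho> j) h t (z j)) \<Longrightarrow> has_multi_caputo M \<rho> q h t (\<Sum>j=1..M. q j *\<^sub>R z j)"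
  unfolding has_multi_caputo_def by blast

lemma has_multi_caputo_lin:
  assumes "has_multi_caputo M \<rho> q h t y" and bl: "bounded_linear L"
  shows "has_multi_caputo M \<rho> q (\<lambda>s. L (h s)) t (L y)"
proof -
  obtain z where z: "\<And>j. j \<in> {1..M} \<Longrightarrow> has_caputo (\<rho> j) h t (z j)" "y = (\<Sum>j=1..M. q j *\<^sub>R z j)"
    using assms(1) unfolding has_multi_caputo_def by blast
  interpret bounded_linear L by fact
  have "L y = (\<Sum>j=1..M. q j *\<^sub>R L (z j))" by (simp add: z(2) sum scaleR)
  then show ?thesis unfolding has_multi_caputo_def
    by (intro exI[of _ "\<lambda>j. L (z j)"] conjI ballI has_caputo_lin[OF z(1) bl])
qed

lemma has_multi_caputo_const: "has_multi_caputo M \<rho> q (\<lambda>s. c) t 0"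
  unfolding has_multi_caputo_def by (rule exI[of _ "\<lambda>_. 0"]) (simp add: has_caputo_const)

lemma has_multi_caputo_add:
  assumes "has_multi_caputo M \<rho> q h t y" "has_multi_caputo M \<rho> q g t x"
  shows "has_multi_caputo M \<rho> q (\<lambda>s. h s + g s) t (y + x)"
proof -
  obtain z z' where z: "\<And>j. j \<in> {1..M} \<Longrightarrow> has_caputo (\<rho> j) h t (z j)" "y = (\<Sum>j=1..M. q j *\<^sub>R z j)"
   "\<And>j. j \<in> {1..M} \<Longrightarrow> has_caputo (\<rho> j) g t (z' j)" "x = (\<Sum>j=1..M. q j *\<^sub>R z' j)"
    using assms unfolding has_multi_caputo_def by metis
  have "y + x = (\<Sum>j=1..M. q j *\<^sub>R (z j + z' j))" by (simp add: z scaleR_add_right sum.distrib)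
  then show ?thesis unfolding has_multi_caputo_def
    by (intro exI[of _ "\<lambda>j. z j + z' j"] conjI ballI has_caputo_add[OF z(1) z(3)])
qed

lemma has_multi_caputo_sum:
  "(\<And>i. i \<in> I \<Longrightarrow> has_multi_caputo M \<rho> q (h i) t (y i)) \<Longrightarrow>
   has_multi_caputo M \<rho> q (\<lambda>s. \<Sum>i\<in>I. h i s) t (\<Sum>i\<in>I. y i)"
proof (induction I rule: infinite_finite_induct)
  case (insert i I)
  then show ?case by (auto intro: has_multi_caputo_add)
qed (simp_all add: has_multi_caputo_const)

lemma has_multi_caputo_cmult:
  fixes h :: "real \<Rightarrow> real"
  shows "has_multi_caputo M \<rho> q h t y \<Longrightarrow> has_multi_caputo M \<rho> q (\<lambda>s. c * h s) t (c * y)"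
  by (rule has_multi_caputo_lin[OF _ bounded_linear_mult_right])

lemma has_multi_caputo_inner:
  fixes h :: "real \<Rightarrow> 'h::{real_inner, banach, second_countable_topology}"
  shows "has_multi_caputo M \<rho> q h t y \<Longrightarrow> has_multi_caputo M \<rho> q (\<lambda>s. inner (h s) x) t (inner y x)"
  by (rule has_multi_caputo_lin[OF _ bounded_linear_inner_left])

lemma admissible_order_range:
  assumes "admissible_coefficients M \<rho> q" "j \<in> {1..M}"
  shows "0 < \<rho> j" "\<rho> j \<le> \<rho> 1" "\<rho> j < 1" "j \<noteq> 1 \<Longrightarrow> \<rho> j < \<rho> 1" "0 < q j"
proof -
  have anti: "\<rho> y < \<rho> x" if "x \<in> {1..M}" "y \<in> {1..M}" "x < y" for x y
    using assms that unfolding admissible_coefficients_def monotone_on_def by blast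
  have "\<rho> M \<le> \<rho> j" using anti[of j M] assms(2) by (cases "j = M") force+
  then show "0 < \<rho> j" using assms(1) by (simp add: admissible_coefficients_def)
  show lt: "\<rho> j < \<rho> 1" if "j \<noteq> 1" using anti[of 1 j] that assms(2) by force
  then show le: "\<rho> j \<le> \<rho> 1" by (cases "j = 1") auto
  then show "\<rho> j < 1" using assms(1) by (simp add: admissible_coefficients_def)
  show "0 < q j" using assms by (simp add: admissible_coefficients_def)
qed

text \<open>The value at \<open>t\<close> of the convolution kernel of the Caputo derivative of order \<open>r\<close>. It decreases in
\<open>t\<close>, so its value at the final time bounds it from below.\<close>

definition memory_weight :: "real \<Rightarrow> real \<Rightarrow> real" where
  "memory_weight r t = 1 / (Gamma (1 - r) * t powr r)"

lemma memory_weight_pos: "0 < t \<Longrightarrow> r < 1 \<Longrightarrow> 0 < memory_weight r t"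
  by (auto simp: memory_weight_def intro!: divide_pos_pos mult_pos_pos Gamma_real_pos)

lemma memory_weight_antimono:
  assumes "0 < s" "s \<le> t" "0 \<le> r" "r < 1"
  shows "memory_weight r t \<le> memory_weight r s"
proof -
  have "s powr r \<le> t powr r" using assms by (intro powr_mono2) auto
  then have "Gamma (1 - r) * s powr r \<le> Gamma (1 - r) * t powr r"
    using assms by (intro mult_left_mono) (auto intro: less_imp_le)
  then show ?thesis unfolding memory_weight_def using assms
    by (intro divide_left_mono mult_pos_pos Gamma_real_pos) auto
qed

text \<open>At a maximum every term of the derivative is nonnegative. Keeping only the term of highest order,
which has coefficient \<open>1\<close>, gives a bound that is uniform in the remaining orders and coefficients.\<close>

lemma multi_caputo_ge_at_max:
  fixes h :: "real \<Rightarrow> real"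
  assumes adm: "admissible_coefficients M \<rho> q"
    and c: "has_multi_caputo M \<rho> q h t y" and cont: "continuous_on {0..t} h"
    and t: "0 < t"
    and max: "\<And>s. s \<in> {0..t} \<Longrightarrow> h s \<le> h t"
  shows "memory_weight (\<rho> 1) t * (h t - h 0) \<le> y"
proof -
  obtain z where z: "\<And>j. j \<in> {1..M} \<Longrightarrow> has_caputo (\<rho> j) h t (z j)" "y = (\<Sum>j=1..M. q j *\<^sub>R z j)"
    using c unfolding has_multi_caputo_def by blast
  have M: "1 \<in> {1..M}" and q1: "q 1 = 1" using adm by (auto simp: admissible_coefficients_def)
  have ge: "memory_weight (\<rho> j) t * (h t - h 0) \<le> z j" if "j \<in> {1..M}" for j
    using caputo_ge_at_max[OF z(1)[OF that] cont t] admissible_order_range[OF adm that] max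
    by (simp add: memory_weight_def)
  have nonneg: "0 \<le> z j" if "j \<in> {1..M}" for j
    using ge[OF that] memory_weight_pos[OF t admissible_order_range(3)[OF adm that]] max[of 0] t
    by (smt (verit) atLeastAtMost_iff mult_nonneg_nonneg)
  have "q 1 * z 1 \<le> (\<Sum>j=1..M. q j * z j)"
  proof (rule member_le_sum[OF M])
    fix j assume "j \<in> {1..M} - {1}"
    then show "0 \<le> q j * z j"
      using nonneg[of j] admissible_order_range(5)[OF adm, of j] by simp
  qed simp
  then show ?thesis using ge[OF M] z(2) q1 by simp
qed

section \<open>Maximum principles\<close>

text \<open>A maximum principle for the Euclidean norm of a diagonal system. At a time \<open>t0\<close> of maximal norm,
Cauchy--Schwarz shows that the scalar function \<open>s \<mapsto> \<langle>w t0, w s\<rangle>\<close> is also maximal over \<open>[0, t0]\<close> at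
\<open>s = t0\<close>. Its derivative there is nonnegative, hence \<open>l \<parallel>w\<parallel>\<^sup>2 \<le> \<langle>w, g\<rangle>\<close> at \<open>t0\<close>. The bound does not
depend on the number of components.\<close>

lemma forced_system_bound:
  fixes w g :: "'i \<Rightarrow> real \<Rightarrow> real"
  assumes adm: "admissible_coefficients M \<rho> q" and fin: "finite I"
    and cont: "\<And>k. k \<in> I \<Longrightarrow> continuous_on {0..\<tau>} (w k)" and w0: "\<And>k. k \<in> I \<Longrightarrow> w k 0 = 0"
    and eq: "\<And>k t. k \<in> I \<Longrightarrow> t \<in> {0<..\<tau>} \<Longrightarrow> has_multi_caputo M \<rho> q (w k) t (g k t - lam k * w k t)"
    and l: "0 < l" "\<And>k. k \<in> I \<Longrightarrow> l \<le> lam k"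
    and G: "\<And>t. t \<in> {0<..\<tau>} \<Longrightarrow> (\<Sum>k\<in>I. (g k t)\<^sup>2) \<le> G\<^sup>2"
    and tau: "0 \<le> \<tau>"
  shows "(\<Sum>k\<in>I. (w k \<tau>)\<^sup>2) \<le> (G / l)\<^sup>2"
proof -
  define S where "S t = (\<Sum>k\<in>I. (w k t)\<^sup>2)" for t
  have "continuous_on {0..\<tau>} S" unfolding S_def by (intro continuous_intros cont)
  then obtain t0 where t0: "t0 \<in> {0..\<tau>}" and tmax: "\<And>t. t \<in> {0..\<tau>} \<Longrightarrow> S t \<le> S t0"
    using continuous_attains_sup[of "{0..\<tau>}" S] tau by auto
  have "S t0 \<le> (G / l)\<^sup>2"
  proof (cases "t0 = 0")
    case True
    then show ?thesis by (simp add: S_def w0)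
  next
    case False
    then have t0p: "t0 \<in> {0<..\<tau>}" "0 < t0" using t0 by auto
    define h where "h s = (\<Sum>k\<in>I. w k t0 * w k s)" for s
    have "h s \<le> h t0" if s: "s \<in> {0..t0}" for s
    proof -
      have "h s \<le> (\<Sum>k\<in>I. ((w k t0)\<^sup>2 + (w k s)\<^sup>2) / 2)"
        unfolding h_def
      proof (rule sum_mono)
        fix k show "w k t0 * w k s \<le> ((w k t0)\<^sup>2 + (w k s)\<^sup>2) / 2"
          using sum_squares_bound[of "w k t0" "w k s"] by simp
      qed
      also have "\<dots> = (S t0 + S s) / 2"
        by (simp add: S_def sum.distrib flip: sum_divide_distrib)
      also have "\<dots> \<le> S t0" using tmax[of s] s t0 by simp
      finally show ?thesis by (simp add: h_def S_def power2_eq_square)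
    qed
    moreover have "has_multi_caputo M \<rho> q h t0 (\<Sum>k\<in>I. w k t0 * (g k t0 - lam k * w k t0))"
      unfolding h_def using eq t0p by (intro has_multi_caputo_sum has_multi_caputo_cmult) auto
    moreover have "continuous_on {0..t0} h"
      unfolding h_def using t0 by (intro continuous_intros continuous_on_subset[OF cont]) auto
    ultimately have "memory_weight (\<rho> 1) t0 * (h t0 - h 0) \<le> (\<Sum>k\<in>I. w k t0 * (g k t0 - lam k * w k t0))"
      using t0p by (intro multi_caputo_ge_at_max[OF adm]) auto
    moreover have "0 \<le> memory_weight (\<rho> 1) t0 * (h t0 - h 0)"
    proof -
      have "0 < memory_weight (\<rho> 1) t0"
        using adm by (intro memory_weight_pos t0p) (simp add: admissible_coefficients_def)
      moreover have "h 0 = 0" "0 \<le> h t0" by (auto simp: h_def w0 intro!: sum_nonneg)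
      ultimately show ?thesis by simp
    qed
    ultimately have "0 \<le> (\<Sum>k\<in>I. w k t0 * (g k t0 - lam k * w k t0))" by linarith
    also have "\<dots> \<le> (\<Sum>k\<in>I. (g k t0)\<^sup>2 / (2 * l) - l / 2 * (w k t0)\<^sup>2)"
    proof (rule sum_mono)
      fix k assume k: "k \<in> I"
      have "0 \<le> (g k t0 - l * w k t0)\<^sup>2 / (2 * l)" using l by simp
      also have "\<dots> = (g k t0)\<^sup>2 / (2 * l) + l / 2 * (w k t0)\<^sup>2 - w k t0 * g k t0"
        using l by (simp add: power2_eq_square field_simps)
      finally have 1: "w k t0 * g k t0 \<le> (g k t0)\<^sup>2 / (2 * l) + l / 2 * (w k t0)\<^sup>2" by simp
      have "l * (w k t0)\<^sup>2 \<le> lam k * (w k t0)\<^sup>2" using l(2)[OF k] by (intro mult_right_mono) auto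
      moreover have "w k t0 * (g k t0 - lam k * w k t0) = w k t0 * g k t0 - lam k * (w k t0)\<^sup>2"
        by (simp add: algebra_simps power2_eq_square)
      ultimately show "w k t0 * (g k t0 - lam k * w k t0) \<le> (g k t0)\<^sup>2 / (2 * l) - l / 2 * (w k t0)\<^sup>2"
        using 1 by simp
    qed
    also have "\<dots> = (\<Sum>k\<in>I. (g k t0)\<^sup>2) / (2 * l) - l / 2 * S t0"
      by (simp add: sum_subtractf S_def sum_distrib_left sum_divide_distrib)
    finally have "l / 2 * S t0 \<le> (\<Sum>k\<in>I. (g k t0)\<^sup>2) / (2 * l)" by simp
    also have "\<dots> \<le> G\<^sup>2 / (2 * l)" using G[OF t0p(1)] l by (intro divide_right_mono) auto
    finally show ?thesis using l by (simp add: field_simps power2_eq_square)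
  qed
  then show ?thesis using tmax[of \<tau>] tau unfolding S_def by force
qed

text \<open>At a minimum \<open>E t0 = m \<le> 1\<close> the derivative is at most \<open>- \<kappa> (1 - m)\<close>, where \<open>\<kappa>\<close> is the memory
weight, while the equation makes it at least \<open>- \<delta> - l m\<close>. Solving for \<open>m\<close> gives the bound. The
memory of the initial value thus prevents any decay in \<open>l\<close> faster than \<open>1 / l\<close>.\<close>

lemma relaxation_lower_bound:
  fixes E r :: "real \<Rightarrow> real"
  assumes adm: "admissible_coefficients M \<rho> q"
    and cont: "continuous_on {0..\<tau>} E" and E0: "E 0 = 1"
    and eq: "\<And>t. t \<in> {0<..\<tau>} \<Longrightarrow> has_multi_caputo M \<rho> q E t (r t - l * E t)"
    and res: "\<And>t. t \<in> {0<..\<tau>} \<Longrightarrow> \<bar>r t\<bar> \<le> \<delta>"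
    and l: "0 < l" and tau: "0 < \<tau>"
  shows "(memory_weight (\<rho> 1) \<tau> - \<delta>) / (memory_weight (\<rho> 1) \<tau> + l) \<le> E \<tau>"
proof -
  let ?\<kappa> = "memory_weight (\<rho> 1)"
  have r1: "0 < \<rho> 1" "\<rho> 1 < 1"
    using admissible_order_range[OF adm, of 1] adm by (auto simp: admissible_coefficients_def)
  have \<kappa>: "0 < ?\<kappa> \<tau>" by (intro memory_weight_pos tau r1)
  have \<delta>: "0 \<le> \<delta>" using res[of \<tau>] tau by force
  obtain t0 where t0: "t0 \<in> {0..\<tau>}" and tmin: "\<And>t. t \<in> {0..\<tau>} \<Longrightarrow> E t0 \<le> E t"
    using continuous_attains_inf[of "{0..\<tau>}" E] tau cont by auto
  have "(?\<kappa> \<tau> - \<delta>) \<le> (?\<kappa> \<tau> + l) * E t0"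
  proof (cases "t0 = 0")
    case True
    then show ?thesis using \<delta> l by (simp add: E0)
  next
    case False
    then have t0p: "t0 \<in> {0<..\<tau>}" "0 < t0" using t0 by auto
    have "?\<kappa> t0 * (- 1 * E t0 - (- 1 * E 0)) \<le> - 1 * (r t0 - l * E t0)"
      using t0 tmin by (intro multi_caputo_ge_at_max[OF adm has_multi_caputo_cmult[OF eq]] t0p
        continuous_intros continuous_on_subset[OF cont]) auto
    moreover have "?\<kappa> \<tau> * (1 - E t0) \<le> ?\<kappa> t0 * (1 - E t0)"
      using tmin[of 0] tau t0p r1 by (intro mult_right_mono memory_weight_antimono) (auto simp: E0)
    ultimately show ?thesis using res[OF t0p(1)] by (simp add: E0 algebra_simps)
  qed
  also have "\<dots> \<le> (?\<kappa> \<tau> + l) * E \<tau>"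
    using tmin[of \<tau>] tau \<kappa> l by (intro mult_left_mono) auto
  finally show ?thesis using \<kappa> l by (simp add: field_simps)
qed

section \<open>Approximate relaxation functions\<close>

text \<open>With \<open>J\<^bsup>\<beta>\<^esup>\<close> the fractional integral of order \<open>\<beta>\<close>, this is \<open>(\<Sum>\<^sub>j a\<^sub>j J\<^bsup>b\<^sub>j\<^esup>)\<^sup>n\<close> applied to
\<open>t\<^sup>s / \<Gamma>(s + 1) = J\<^sup>s 1\<close>. Since \<open>J\<^bsup>\<beta>\<^esup>\<close> acts on such powers by raising the exponent \<open>s\<close>, the iterates can
be written without integrals by letting \<open>s\<close> vary.\<close>

primrec volterra_iterate ::
    "nat \<Rightarrow> (nat \<Rightarrow> real) \<Rightarrow> (nat \<Rightarrow> real) \<Rightarrow> nat \<Rightarrow> real \<Rightarrow> real \<Rightarrow> real" where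
  "volterra_iterate M a b 0 s t = t powr s / Gamma (s + 1)"
| "volterra_iterate M a b (Suc n) s t = (\<Sum>j=1..M. a j * volterra_iterate M a b n (s + b j) t)"

text \<open>The part of the Gamma integral over \<open>[x, \<infinity>)\<close> alone is at least the left-hand side.\<close>

lemma Gamma_ge_powr_exp:
  assumes "0 \<le> s" "0 < (x::real)"
  shows "x powr s * exp (- x) \<le> Gamma (s + 1)"
proof -
  have 1: "((\<lambda>t. t powr s / exp t) has_integral Gamma (s + 1)) {0..}"
    using Gamma_integral_real[of "s + 1"] assms by simp
  have "((\<lambda>t. exp (- 1 * t)) has_integral (exp (- 1 * x) / 1)) {x..}"
    by (rule has_integral_exp_minus_to_infinity) simp
  then have 2: "((\<lambda>t. x powr s * exp (- t)) has_integral x powr s * exp (- x)) {x..}"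
    by (intro has_integral_mult_right) simp
  have 3: "((\<lambda>t. if t \<in> {x..} then x powr s * exp (- t) else 0) has_integral x powr s * exp (- x)) {0..}"
    using 2 assms by (subst has_integral_restrict) auto
  show ?thesis
  proof (rule has_integral_le[OF 3 1])
    fix t :: real assume "t \<in> {0..}"
    then show "(if t \<in> {x..} then x powr s * exp (- t) else 0) \<le> t powr s / exp t"
      using assms by (auto simp: exp_minus field_simps intro!: powr_mono2)
  qed
qed

text \<open>The bound \<open>t\<^sup>s / \<Gamma>(s + 1) \<le> \<mu>\<^bsup>-s\<^esup> exp (\<mu> t)\<close> trades each fractional integration \<open>J\<^bsup>b\<^sub>j\<^esup>\<close> for a factor
\<open>\<mu>\<^bsup>-b\<^sub>j\<^esup>\<close>. If all \<open>b\<^sub>j\<close> are positive, a large \<open>\<mu>\<close> turns the iteration into a contraction in the norm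
weighted by \<open>exp (- \<mu> t)\<close>.\<close>

lemma volterra_iterate_bounds:
  assumes a: "\<And>j. j \<in> {1..M} \<Longrightarrow> 0 \<le> a j" and b: "\<And>j. j \<in> {1..M} \<Longrightarrow> 0 \<le> b j"
    and \<mu>: "0 < \<mu>" and t: "0 < t" and s: "0 \<le> s"
  shows "0 \<le> volterra_iterate M a b n s t"
    and "volterra_iterate M a b n s t \<le> (\<Sum>j=1..M. a j * \<mu> powr (- b j)) ^ n * \<mu> powr (- s) * exp (\<mu> * t)"
proof -
  let ?Q = "\<Sum>j=1..M. a j * \<mu> powr (- b j)"
  have "0 \<le> volterra_iterate M a b n s t \<and>
    volterra_iterate M a b n s t \<le> ?Q ^ n * \<mu> powr (- s) * exp (\<mu> * t)" using s
  proof (induction n arbitrary: s)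
    case 0
    have G: "0 < Gamma (s + 1)" using 0 by (intro Gamma_real_pos) auto
    have "(\<mu> * t) powr s * exp (- (\<mu> * t)) \<le> Gamma (s + 1)"
      using 0 \<mu> t by (intro Gamma_ge_powr_exp) auto
    then have "t powr s \<le> Gamma (s + 1) * (\<mu> powr (- s) * exp (\<mu> * t))"
      using \<mu> t by (simp add: powr_mult powr_minus exp_minus field_simps)
    then show ?case using G by (simp add: field_simps)
  next
    case (Suc n)
    have IH: "0 \<le> volterra_iterate M a b n (s + b j) t"
      "volterra_iterate M a b n (s + b j) t \<le> ?Q ^ n * \<mu> powr (- (s + b j)) * exp (\<mu> * t)"
      if "j \<in> {1..M}" for j using Suc.IH[of "s + b j"] b[OF that] Suc.prems by auto
    have "(\<Sum>j=1..M. a j * volterra_iterate M a b n (s + b j) t)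
      \<le> (\<Sum>j=1..M. a j * (?Q ^ n * \<mu> powr (- (s + b j)) * exp (\<mu> * t)))"
      using IH a by (intro sum_mono mult_left_mono) auto
    also have "\<dots> = (\<Sum>j=1..M. (a j * \<mu> powr (- b j)) * (?Q ^ n * \<mu> powr (- s) * exp (\<mu> * t)))"
    proof (intro sum.cong refl)
      fix j
      have "\<mu> powr (- (s + b j)) = \<mu> powr (- b j) * \<mu> powr (- s)"
        by (simp add: add.commute flip: powr_add)
      then show "a j * (?Q ^ n * \<mu> powr (- (s + b j)) * exp (\<mu> * t))
        = (a j * \<mu> powr (- b j)) * (?Q ^ n * \<mu> powr (- s) * exp (\<mu> * t))" by simp
    qed
    also have "\<dots> = ?Q ^ Suc n * \<mu> powr (- s) * exp (\<mu> * t)"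
      by (simp flip: sum_distrib_right)
    finally show ?case using IH a by (auto intro!: sum_nonneg mult_nonneg_nonneg)
  qed
  then show "0 \<le> volterra_iterate M a b n s t"
    and "volterra_iterate M a b n s t \<le> ?Q ^ n * \<mu> powr (- s) * exp (\<mu> * t)" by auto
qed

text \<open>This includes \<open>s = 0\<close>, because \<open>0 powr 0 = 0\<close>.\<close>

lemma volterra_iterate_at_0: "volterra_iterate M a b n s 0 = 0"
  by (induction n arbitrary: s) auto

lemma continuous_on_volterra_iterate:
  assumes "\<And>j. j \<in> {1..M} \<Longrightarrow> 0 \<le> b j" "0 < s"
  shows "continuous_on {0..T} (volterra_iterate M a b n s)"
  using assms(2)
proof (induction n arbitrary: s)
  case 0
  have "continuous_on {0..T} (\<lambda>t. t powr s)"
    using 0 by (intro continuous_on_powr') (auto intro!: continuous_intros)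
  moreover have "Gamma (s + 1) \<noteq> 0" using Gamma_real_pos[of "s + 1"] 0 by linarith
  ultimately show ?case by (simp add: continuous_on_divide)
next
  case (Suc n)
  have "continuous_on {0..T} (volterra_iterate M a b n (s + b j))" if "j \<in> {1..M}" for j
    using Suc assms(1)[OF that] by auto
  then show ?case by (auto intro!: continuous_intros)
qed

lemma has_caputo_volterra_iterate:
  assumes b: "\<And>j. j \<in> {1..M} \<Longrightarrow> 0 \<le> b j" and r: "0 < r" "r < 1" "r \<le> s" and t: "0 < t"
  shows "has_caputo r (volterra_iterate M a b n s) t (volterra_iterate M a b n (s - r) t)"
  using r(3)
proof (induction n arbitrary: s)
  case 0
  have "(volterra_iterate M a b 0 s) = (\<lambda>t. t powr s / Gamma (s + 1))" by auto
  then show ?case using has_caputo_powr[OF t, of s r] 0 r by simp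
next
  case (Suc n)
  have eq: "volterra_iterate M a b (Suc n) s = (\<lambda>t. \<Sum>j=1..M. a j *\<^sub>R volterra_iterate M a b n (s + b j) t)"
    by auto
  have eq': "volterra_iterate M a b (Suc n) (s - r) t
      = (\<Sum>j=1..M. a j *\<^sub>R volterra_iterate M a b n ((s + b j) - r) t)"
    by (simp add: algebra_simps)
  have "has_caputo r (volterra_iterate M a b n (s + b j)) t (volterra_iterate M a b n ((s + b j) - r) t)"
    if "j \<in> {1..M}" for j using Suc b[OF that] by auto
  then show ?case unfolding eq eq' by (intro has_caputo_sum has_caputo_scale) auto
qed

text \<open>Write \<open>P = \<partial>\<^bsup>\<rho>\<^sub>1\<^esup> (1 + Q)\<close> with \<open>Q = \<Sum>\<^bsub>j\<ge>2\<^esub> q\<^sub>j J\<^bsup>\<rho>\<^sub>1-\<rho>\<^sub>j\<^esup>\<close>. For \<open>E = 1 + e\<close> the equation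
\<open>P E + l E = 0\<close> becomes \<open>(1 + Q + l J\<^bsup>\<rho>\<^sub>1\<^esup>) e = - l J\<^bsup>\<rho>\<^sub>1\<^esup> 1\<close>, which is solved by the Neumann series
\<open>e = - l \<Sum>\<^sub>n (-1)\<^sup>n (Q + l J\<^bsup>\<rho>\<^sub>1\<^esup>)\<^sup>n J\<^bsup>\<rho>\<^sub>1\<^esup> 1\<close>. Cutting the series after \<open>N\<close> terms leaves exactly the residual
\<open>l (-1)\<^sup>N (Q + l J\<^bsup>\<rho>\<^sub>1\<^esup>)\<^sup>N 1\<close>, which the contraction bound makes small.\<close>

lemma approximate_relaxation_function:
  fixes l :: real
  assumes adm: "admissible_coefficients M \<rho> q" and l: "0 < l" and \<delta>: "0 < \<delta>"
  shows "\<exists>E r. continuous_on {0..T} E \<and> E 0 = 1 \<and>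
    (\<forall>t\<in>{0<..T}. \<bar>r t\<bar> \<le> \<delta> \<and> has_multi_caputo M \<rho> q E t (r t - l * E t))"
proof -
  \<comment> \<open>The operator \<open>Q + l J\<^bsup>\<rho>\<^sub>1\<^esup>\<close>; its last summand takes the place that \<open>j = 1\<close> leaves free in \<open>Q\<close>.\<close>
  define a where "a j = (if j = 1 then l else q j)" for j :: nat
  define b where "b j = (if j = 1 then \<rho> 1 else \<rho> 1 - \<rho> j)" for j
  have M: "1 \<in> {1..M}" and q1: "q 1 = 1" using adm by (auto simp: admissible_coefficients_def)
  have b: "0 < b j" if "j \<in> {1..M}" for j
    using admissible_order_range[OF adm that] admissible_order_range(1)[OF adm M] by (auto simp: b_def)
  have a: "0 < a j" if "j \<in> {1..M}" for j
    using admissible_order_range(5)[OF adm that] l by (auto simp: a_def)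
  have "((\<lambda>\<mu>. \<Sum>j=1..M. a j * \<mu> powr (- b j)) \<longlongrightarrow> (\<Sum>j=1..M. a j * 0)) at_top"
  proof (intro tendsto_sum tendsto_mult tendsto_const)
    fix j assume "j \<in> {1..M}"
    then show "((\<lambda>\<mu>. \<mu> powr (- b j)) \<longlongrightarrow> 0) at_top"
      using b by (intro tendsto_neg_powr filterlim_ident) auto
  qed
  then have "\<forall>\<^sub>F \<mu> in at_top. (\<Sum>j=1..M. a j * \<mu> powr (- b j)) < 1 / 2"
    by (intro order_tendstoD(2)[where y = "\<Sum>j=1..M. a j * 0"]) auto
  then have "\<forall>\<^sub>F \<mu> in at_top. (\<Sum>j=1..M. a j * \<mu> powr (- b j)) < 1 / 2 \<and> 0 < \<mu>"
    using eventually_gt_at_top[of 0] by eventually_elim auto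
  then obtain \<mu> where \<mu>: "0 < \<mu>" and Q: "(\<Sum>j=1..M. a j * \<mu> powr (- b j)) < 1 / 2"
    by (auto dest: eventually_happens)
  obtain N where N: "(1 / 2 :: real) ^ N < \<delta> / (l * exp (\<mu> * T))"
    using real_arch_pow_inv[of "\<delta> / (l * exp (\<mu> * T))" "1/2"] \<delta> l by auto
  define W where "W = volterra_iterate M a b"
  define E where "E t = 1 - l * (\<Sum>n<N. (-1) ^ n * W n (\<rho> 1) t)" for t
  define r where "r t = l * (-1) ^ N * W N 0 t" for t
  have \<rho>1: "0 < \<rho> 1" using admissible_order_range(1)[OF adm M] .
  have "\<bar>r t\<bar> \<le> \<delta>" if t: "t \<in> {0<..T}" for t
  proof -
    have bds: "0 \<le> W N 0 t"
      "W N 0 t \<le> (\<Sum>j=1..M. a j * \<mu> powr (- b j)) ^ N * \<mu> powr (- 0) * exp (\<mu> * t)"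
      unfolding W_def using t \<mu> a b
      by (intro volterra_iterate_bounds; force intro: less_imp_le)+
    have "0 \<le> (\<Sum>j=1..M. a j * \<mu> powr (- b j))"
      using a by (intro sum_nonneg mult_nonneg_nonneg) (auto intro: less_imp_le)
    then have "(\<Sum>j=1..M. a j * \<mu> powr (- b j)) ^ N \<le> (1 / 2) ^ N"
      using Q by (intro power_mono) auto
    then have "(\<Sum>j=1..M. a j * \<mu> powr (- b j)) ^ N * exp (\<mu> * t) \<le> (1 / 2) ^ N * exp (\<mu> * T)"
      using t \<mu> by (intro mult_mono) auto
    then have "W N 0 t \<le> (1 / 2) ^ N * exp (\<mu> * T)" using bds \<mu> by simp
    then have "l * W N 0 t \<le> l * ((1 / 2) ^ N * exp (\<mu> * T))" using l by (intro mult_left_mono) auto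
    also have "\<dots> \<le> \<delta>" using N l by (simp add: field_simps)
    finally show ?thesis using bds l by (simp add: r_def abs_mult power_abs)
  qed
  moreover have "has_multi_caputo M \<rho> q E t (r t - l * E t)" if t: "t \<in> {0<..T}" for t
  proof -
    have one: "W 0 0 t = 1" using t by (simp add: W_def)
    have cap: "has_caputo (\<rho> j) (W n (\<rho> 1)) t (W n (\<rho> 1 - \<rho> j) t)" if "j \<in> {1..M}" for n j
      unfolding W_def using b t admissible_order_range[OF adm that]
      by (intro has_caputo_volterra_iterate) (auto intro: less_imp_le)
    have WM: "has_multi_caputo M \<rho> q (W n (\<rho> 1)) t (\<Sum>j=1..M. q j *\<^sub>R W n (\<rho> 1 - \<rho> j) t)" for n
      by (intro has_multi_caputoI cap)
    have sum: "(\<Sum>j=1..M. q j *\<^sub>R W n (\<rho> 1 - \<rho> j) t) = W n 0 t + W (Suc n) 0 t - l * W n (\<rho> 1) t" for n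
    proof -
      have "(\<Sum>j\<in>{1..M}-{1}. q j * W n (\<rho> 1 - \<rho> j) t) = (\<Sum>j\<in>{1..M}-{1}. a j * W n (b j) t)"
        by (intro sum.cong) (auto simp: a_def b_def)
      then show ?thesis
        using sum.remove[OF _ M, of "\<lambda>j. q j * W n (\<rho> 1 - \<rho> j) t"]
          sum.remove[OF _ M, of "\<lambda>j. a j * W n (b j) t"] q1
        by (simp add: W_def a_def b_def)
    qed
    \<comment> \<open>The sum telescopes, which leaves the initial value \<open>1\<close> and the residual.\<close>
    have tele: "(\<Sum>n<K. (-1) ^ n * (W n 0 t + W (Suc n) 0 t)) = W 0 0 t - (-1) ^ K * W K 0 t" for K
      by (induction K) (auto simp: algebra_simps)
    have "has_multi_caputo M \<rho> q E t
      (0 + - l * (\<Sum>n<N. (-1) ^ n * (W n 0 t + W (Suc n) 0 t - l * W n (\<rho> 1) t)))"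
    proof -
      have "E = (\<lambda>t. 1 + - l * (\<Sum>n<N. (-1) ^ n * W n (\<rho> 1) t))" by (auto simp: E_def)
      then show ?thesis
        using WM unfolding sum
        by (simp only:) (intro has_multi_caputo_add has_multi_caputo_const has_multi_caputo_cmult has_multi_caputo_sum)
    qed
    moreover have "0 + - l * (\<Sum>n<N. (-1) ^ n * (W n 0 t + W (Suc n) 0 t - l * W n (\<rho> 1) t)) = r t - l * E t"
    proof -
      define S where "S = (\<Sum>n<N. (-1) ^ n * W n (\<rho> 1) t)"
      have "(\<Sum>n<N. (-1) ^ n * (W n 0 t + W (Suc n) 0 t - l * W n (\<rho> 1) t))
        = (\<Sum>n<N. (-1) ^ n * (W n 0 t + W (Suc n) 0 t)) - l * S"
        by (simp add: S_def right_diff_distrib sum_subtractf sum_distrib_left mult.left_commute)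
      moreover have "E t = 1 - l * S" by (simp add: E_def S_def)
      ultimately show ?thesis unfolding tele one r_def by (simp only:) (simp add: algebra_simps)
    qed
    ultimately show ?thesis by simp
  qed
  moreover have "continuous_on {0..T} E"
    unfolding E_def[abs_def] W_def using b \<rho>1
    by (intro continuous_intros continuous_on_volterra_iterate) (auto intro: less_imp_le)
  moreover have "E 0 = 1" by (simp add: E_def W_def volterra_iterate_at_0)
  ultimately show ?thesis by blast
qed

section \<open>Interpolation and orthonormal systems\<close>

text \<open>After division by the two sums on the right, each term is bounded by a weighted mean (Young), and
the means add up to \<open>\<alpha> + \<beta> = 1\<close>.\<close>

lemma Holder_sum_powr:
  fixes p r :: "'i \<Rightarrow> real"
  assumes p: "\<And>i. i \<in> I \<Longrightarrow> 0 \<le> p i" and r: "\<And>i. i \<in> I \<Longrightarrow> 0 \<le> r i"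
    and \<alpha>: "0 < \<alpha>" and \<beta>: "0 < \<beta>" and one: "\<alpha> + \<beta> = 1" and fin: "finite I"
  shows "(\<Sum>i\<in>I. p i powr \<alpha> * r i powr \<beta>) \<le> (\<Sum>i\<in>I. p i) powr \<alpha> * (\<Sum>i\<in>I. r i) powr \<beta>"
proof -
  define P where "P = (\<Sum>i\<in>I. p i)"
  define R where "R = (\<Sum>i\<in>I. r i)"
  have nn: "0 \<le> P" "0 \<le> R" unfolding P_def R_def using p r by (auto intro!: sum_nonneg)
  show ?thesis
  proof (cases "P = 0 \<or> R = 0")
    case True
    then have "(\<forall>i\<in>I. p i = 0) \<or> (\<forall>i\<in>I. r i = 0)"
      using p r fin by (auto simp: P_def R_def sum_nonneg_eq_0_iff)
    then have "(\<Sum>i\<in>I. p i powr \<alpha> * r i powr \<beta>) = 0" by (intro sum.neutral) auto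
    then show ?thesis by simp
  next
    case False
    then have PR: "0 < P" "0 < R" using nn by auto
    have le: "p i powr \<alpha> * r i powr \<beta> \<le> P powr \<alpha> * R powr \<beta> * (\<alpha> * (p i / P) + \<beta> * (r i / R))"
      if i: "i \<in> I" for i
    proof (cases "p i = 0 \<or> r i = 0")
      case True
      have "0 \<le> \<alpha> * (p i / P) + \<beta> * (r i / R)"
        using p[OF i] r[OF i] PR \<alpha> \<beta> by (intro add_nonneg_nonneg mult_nonneg_nonneg divide_nonneg_nonneg) auto
      then have "0 \<le> P powr \<alpha> * R powr \<beta> * (\<alpha> * (p i / P) + \<beta> * (r i / R))" by (intro mult_nonneg_nonneg) auto
      then show ?thesis using True by (metis mult_zero_left mult_zero_right powr_0)
    next
      case False
      then have pr: "0 < p i" "0 < r i" using p[OF i] r[OF i] by auto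
      have "(p i / P) powr \<alpha> * (r i / R) powr \<beta> \<le> \<alpha> * (p i / P) + \<beta> * (r i / R)"
        using \<alpha> \<beta> one pr PR by (intro Youngs_inequality_0) auto
      then have "P powr \<alpha> * R powr \<beta> * ((p i / P) powr \<alpha> * (r i / R) powr \<beta>)
          \<le> P powr \<alpha> * R powr \<beta> * (\<alpha> * (p i / P) + \<beta> * (r i / R))"
        by (intro mult_left_mono) auto
      then show ?thesis using pr PR by (simp add: powr_divide)
    qed
    have "(\<Sum>i\<in>I. p i powr \<alpha> * r i powr \<beta>)
        \<le> (\<Sum>i\<in>I. P powr \<alpha> * R powr \<beta> * (\<alpha> * (p i / P) + \<beta> * (r i / R)))"
      by (intro sum_mono le)
    also have "\<dots> = P powr \<alpha> * R powr \<beta> * (\<alpha> * (P / P) + \<beta> * (R / R))"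
      by (simp add: P_def R_def sum.distrib flip: sum_distrib_left sum_divide_distrib)
    also have "\<dots> = P powr \<alpha> * R powr \<beta>" using PR one by simp
    finally show ?thesis by (simp add: P_def R_def)
  qed
qed

text \<open>The exponents are those for which the powers of \<open>lam i\<close> cancel in
\<open>((x i / lam i)\<^sup>2) powr \<alpha> * (lam i powr (2 * \<epsilon>) * (x i)\<^sup>2) powr \<beta>\<close>, that is \<open>\<alpha> = \<epsilon> \<beta>\<close> and
\<open>\<alpha> + \<beta> = 1\<close>.\<close>

lemma power_scale_interpolation:
  fixes x lam :: "'i \<Rightarrow> real"
  assumes fin: "finite I" and lam: "\<And>i. i \<in> I \<Longrightarrow> 0 < lam i" and \<epsilon>: "0 < \<epsilon>"
  shows "(\<Sum>i\<in>I. (x i)\<^sup>2) \<le> (\<Sum>i\<in>I. (x i / lam i)\<^sup>2) powr (\<epsilon> / (1 + \<epsilon>))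
           * (\<Sum>i\<in>I. lam i powr (2 * \<epsilon>) * (x i)\<^sup>2) powr (1 / (1 + \<epsilon>))"
proof -
  let ?\<alpha> = "\<epsilon> / (1 + \<epsilon>)" and ?\<beta> = "1 / (1 + \<epsilon>)"
  have one: "?\<alpha> + ?\<beta> = 1" using \<epsilon> by (simp add: field_simps)
  have "(x i)\<^sup>2 = ((x i / lam i)\<^sup>2) powr ?\<alpha> * (lam i powr (2 * \<epsilon>) * (x i)\<^sup>2) powr ?\<beta>" if i: "i \<in> I" for i
  proof (cases "x i = 0")
    case False
    define y where "y = (x i)\<^sup>2"
    have y: "0 < y" using False by (simp add: y_def)
    have "(x i / lam i)\<^sup>2 = y * lam i powr (-2)"
      using lam[OF i] by (simp add: y_def powr_minus divide_inverse powr_numeral power_mult_distrib power_inverse)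
    then have "((x i / lam i)\<^sup>2) powr ?\<alpha> * (lam i powr (2 * \<epsilon>) * y) powr ?\<beta>
      = (y powr ?\<alpha> * y powr ?\<beta>) * (lam i powr (-2 * ?\<alpha>) * lam i powr (2 * \<epsilon> * ?\<beta>))"
      using y lam[OF i] by (simp add: powr_mult powr_powr)
    also have "\<dots> = y powr (?\<alpha> + ?\<beta>) * lam i powr (-2 * ?\<alpha> + 2 * \<epsilon> * ?\<beta>)"
      by (simp only: powr_add)
    also have "-2 * ?\<alpha> + 2 * \<epsilon> * ?\<beta> = 0" by simp
    finally show ?thesis using y lam[OF i] unfolding one y_def by simp
  qed simp
  then have "(\<Sum>i\<in>I. (x i)\<^sup>2)
      = (\<Sum>i\<in>I. ((x i / lam i)\<^sup>2) powr ?\<alpha> * (lam i powr (2 * \<epsilon>) * (x i)\<^sup>2) powr ?\<beta>)"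
    by (rule sum.cong[OF refl])
  also have "\<dots> \<le> (\<Sum>i\<in>I. (x i / lam i)\<^sup>2) powr ?\<alpha> * (\<Sum>i\<in>I. lam i powr (2 * \<epsilon>) * (x i)\<^sup>2) powr ?\<beta>"
    using \<epsilon> one fin by (intro Holder_sum_powr) auto
  finally show ?thesis .
qed

lemma norm_sum_orthonormal:
  fixes v :: "'i \<Rightarrow> 'h::real_inner"
  assumes v: "\<And>i j. inner (v i) (v j) = (if i = j then 1 else 0)" and fin: "finite I"
  shows "(norm (\<Sum>k\<in>I. c k *\<^sub>R v k))\<^sup>2 = (\<Sum>k\<in>I. (c k)\<^sup>2)"
  using fin unfolding power2_norm_eq_inner
  by (simp add: inner_sum_left inner_sum_right v power2_eq_square if_distrib cong: if_cong)

lemma bessel_inequality: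
  fixes v :: "'i \<Rightarrow> 'h::real_inner"
  assumes v: "\<And>i j. inner (v i) (v j) = (if i = j then 1 else 0)" and fin: "finite I"
  shows "L2_set (\<lambda>k. inner x (v k)) I \<le> norm x"
proof -
  let ?P = "\<Sum>k\<in>I. inner x (v k) *\<^sub>R v k"
  have "inner x ?P = (\<Sum>k\<in>I. (inner x (v k))\<^sup>2)"
    by (simp add: inner_sum_right power2_eq_square)
  moreover have "inner ?P ?P = (\<Sum>k\<in>I. (inner x (v k))\<^sup>2)"
    using norm_sum_orthonormal[OF v fin] by (simp add: power2_norm_eq_inner)
  moreover have "0 \<le> inner (x - ?P) (x - ?P)" by simp
  ultimately have "(\<Sum>k\<in>I. (inner x (v k))\<^sup>2) \<le> (norm x)\<^sup>2"
    by (simp add: inner_diff_left inner_diff_right inner_commute power2_norm_eq_inner)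
  then show ?thesis unfolding L2_set_def by (simp add: real_le_lsqrt)
qed

text \<open>The part of Parseval's identity that needs completeness. The inequality \<open>(x \<bullet> y)\<^sup>2 \<le> B \<parallel>y\<parallel>\<^sup>2\<close> holds for
finite linear combinations \<open>y\<close> by Cauchy--Schwarz, hence by density for \<open>y = x\<close>.\<close>

lemma norm_le_of_coefficients:
  fixes v :: "nat \<Rightarrow> 'h::real_inner"
  assumes v: "\<And>i j. inner (v i) (v j) = (if i = j then 1 else 0)"
    and dense: "closure (span (range v)) = UNIV"
    and B: "\<And>N. (\<Sum>k<N. (inner x (v k))\<^sup>2) \<le> B"
  shows "(norm x)\<^sup>2 \<le> B"
proof -
  let ?S = "{y. (inner x y)\<^sup>2 \<le> B * (norm y)\<^sup>2}"
  have "span (range v) \<subseteq> ?S"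
  proof
    fix y assume "y \<in> span (range v)"
    then obtain t d where t: "finite t" "t \<subseteq> range v" "y = (\<Sum>a\<in>t. d a *\<^sub>R a)"
      by (auto simp: span_explicit)
    then obtain C where C: "finite C" "t = v ` C" using finite_subset_image[of t v UNIV] by auto
    have "inj v" using v by (intro injI) (metis zero_neq_one)
    then have y: "y = (\<Sum>k\<in>C. d (v k) *\<^sub>R v k)"
      using t(3) unfolding C(2) by (subst (asm) sum.reindex) (auto intro: inj_on_subset)
    obtain N where N: "C \<subseteq> {..<N}" using finite_nat_bounded[OF C(1)] by auto
    have "(\<Sum>k\<in>C. (inner x (v k))\<^sup>2) \<le> (\<Sum>k<N. (inner x (v k))\<^sup>2)"
      using N by (intro sum_mono2) auto
    also note B
    finally have CB: "(\<Sum>k\<in>C. (inner x (v k))\<^sup>2) \<le> B" .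
    have "(inner x y)\<^sup>2 = (\<Sum>k\<in>C. inner x (v k) * d (v k))\<^sup>2"
      by (simp add: y inner_sum_right mult.commute)
    also have "\<dots> \<le> (\<Sum>k\<in>C. (inner x (v k))\<^sup>2) * (\<Sum>k\<in>C. (d (v k))\<^sup>2)"
      by (rule Cauchy_Schwarz_ineq_sum)
    also have "\<dots> \<le> B * (\<Sum>k\<in>C. (d (v k))\<^sup>2)"
      by (intro mult_right_mono CB sum_nonneg) auto
    also have "(\<Sum>k\<in>C. (d (v k))\<^sup>2) = (norm y)\<^sup>2"
      unfolding y by (rule norm_sum_orthonormal[OF v C(1), symmetric])
    finally show "y \<in> ?S" by simp
  qed
  moreover have "closed ?S" by (intro closed_Collect_le continuous_intros)
  ultimately have "x \<in> ?S" using closure_minimal dense by blast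
  then have "(norm x)\<^sup>2 * (norm x)\<^sup>2 \<le> B * (norm x)\<^sup>2"
    by (simp only: mem_Collect_eq power2_norm_eq_inner power2_eq_square[of "inner x x"])
  moreover have "0 \<le> B" using B[of 0] by simp
  ultimately show ?thesis using mult_right_le_imp_le[of "(norm x)\<^sup>2" "(norm x)\<^sup>2" B]
    by (cases "x = 0") simp_all
qed

text \<open>The series converges because its partial sums are Cauchy exactly when those of \<open>(c k)\<^sup>2\<close> are.\<close>

lemma orthonormal_series_norm:
  fixes v :: "nat \<Rightarrow> 'h::{real_inner, banach}"
  assumes v: "\<And>i j. inner (v i) (v j) = (if i = j then 1 else 0)"
    and c: "summable (\<lambda>k. (c k)\<^sup>2)"
  shows "(\<Sum>k<N. (c k)\<^sup>2) \<le> (norm (\<Sum>k. c k *\<^sub>R v k))\<^sup>2"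
proof -
  have "summable (\<lambda>k. c k *\<^sub>R v k)"
    unfolding summable_Cauchy
  proof (intro allI impI)
    fix e :: real assume e: "0 < e"
    obtain K where K: "\<And>m n. K \<le> m \<Longrightarrow> norm (\<Sum>k=m..<n. (c k)\<^sup>2) < e\<^sup>2"
      using c e unfolding summable_Cauchy by (meson zero_less_power)
    have "norm (\<Sum>k=m..<n. c k *\<^sub>R v k) < e" if "K \<le> m" for m n
    proof -
      have "(norm (\<Sum>k=m..<n. c k *\<^sub>R v k))\<^sup>2 < e\<^sup>2"
        using K[OF that, of n] norm_sum_orthonormal[OF v, of "{m..<n}" c]
        by (simp add: sum_nonneg)
      then show ?thesis using e by (simp add: power2_less_imp_less)
    qed
    then show "\<exists>N. \<forall>m\<ge>N. \<forall>n. norm (\<Sum>k=m..<n. c k *\<^sub>R v k) < e" by blast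
  qed
  then have "(\<lambda>n. \<Sum>k<n. c k *\<^sub>R v k) \<longlonglongrightarrow> (\<Sum>k. c k *\<^sub>R v k)" by (rule summable_LIMSEQ)
  then have lim: "(\<lambda>n. (norm (\<Sum>k<n. c k *\<^sub>R v k))\<^sup>2) \<longlonglongrightarrow> (norm (\<Sum>k. c k *\<^sub>R v k))\<^sup>2"
    by (intro tendsto_intros)
  have eq: "(norm (\<Sum>k<n. c k *\<^sub>R v k))\<^sup>2 = (\<Sum>k<n. (c k)\<^sup>2)" for n
    by (rule norm_sum_orthonormal[OF v]) simp
  have "incseq (\<lambda>n. \<Sum>k<n. (c k)\<^sup>2)" by (intro incseq_SucI) simp
  then show ?thesis using lim unfolding eq by (rule incseq_le)
qed

section \<open>Recovering the initial value\<close>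

lemma L2_set_abs: "L2_set (\<lambda>k. \<bar>h k\<bar>) I = L2_set h I"
  by (simp add: L2_set_def)

text \<open>Splits \<open>u\<^sub>k = \<phi>\<^sub>k E\<^sub>k + w\<^sub>k\<close> with approximate relaxation functions \<open>E\<^sub>k\<close>. The forcing of \<open>w\<^sub>k\<close> is
\<open>f\<^sub>k - \<phi>\<^sub>k r\<^sub>k\<close> with \<open>r\<^sub>k\<close> the residual of \<open>E\<^sub>k\<close>. The residual enters twice, in the bound for \<open>w\<close> and in
the lower bound for \<open>E\<^sub>k\<close>, each time with a contribution of at most \<open>\<delta> \<parallel>u 0\<parallel> / l\<close>.\<close>

lemma initial_value_weak_bound:
  fixes u f :: "real \<Rightarrow> 'h::{real_inner, banach, second_countable_topology}" and v :: "nat \<Rightarrow> 'h"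
  assumes adm: "admissible_coefficients M \<rho> q"
    and v: "\<And>i j. inner (v i) (v j) = (if i = j then 1 else 0)"
    and l: "0 < l" "\<And>k. l \<le> lam k"
    and tau: "0 < \<tau>" and cont: "continuous_on {0..\<tau>} u"
    and eq: "\<And>k t. t \<in> {0<..\<tau>} \<Longrightarrow>
      has_multi_caputo M \<rho> q (\<lambda>s. inner (u s) (v k)) t (inner (f t) (v k) - lam k * inner (u t) (v k))"
    and F: "\<And>t. t \<in> {0<..\<tau>} \<Longrightarrow> norm (f t) \<le> F"
  shows "L2_set (\<lambda>k. memory_weight (\<rho> 1) \<tau> / (memory_weight (\<rho> 1) \<tau> + lam k) * inner (u 0) (v k)) {..<N}
     \<le> norm (u \<tau>) + F / l"
proof (rule field_le_epsilon)
  fix e :: real assume e: "0 < e"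
  \<comment> \<open>Chosen so that the two contributions of the residual add up to at most \<open>e\<close>.\<close>
  define \<delta> where "\<delta> = e * l / (2 * (norm (u 0) + 1))"
  have n0: "0 < norm (u 0) + 1" by (simp add: add_nonneg_pos)
  have \<delta>: "0 < \<delta>" unfolding \<delta>_def using e l(1) n0 by (intro divide_pos_pos mult_pos_pos) auto
  have lam: "0 < lam k" for k using l(1) l(2)[of k] by linarith
  have "\<forall>k. \<exists>E r. continuous_on {0..\<tau>} E \<and> E 0 = 1 \<and>
    (\<forall>t\<in>{0<..\<tau>}. \<bar>r t\<bar> \<le> \<delta> \<and> has_multi_caputo M \<rho> q E t (r t - lam k * E t))"
    using approximate_relaxation_function[OF adm lam \<delta>] by blast
  then obtain E r where cE: "\<And>k. continuous_on {0..\<tau>} (E k)" and E0: "\<And>k. E k 0 = 1"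
    and res: "\<And>k t. t \<in> {0<..\<tau>} \<Longrightarrow> \<bar>r k t\<bar> \<le> \<delta>"
    and eqE: "\<And>k t. t \<in> {0<..\<tau>} \<Longrightarrow> has_multi_caputo M \<rho> q (E k) t (r k t - lam k * E k t)"
    by metis
  define \<phi> where "\<phi> k = inner (u 0) (v k)" for k
  define w where "w k s = inner (u s) (v k) + - \<phi> k * E k s" for k s
  define g where "g k t = inner (f t) (v k) + - \<phi> k * r k t" for k t
  define G where "G = F + \<delta> * norm (u 0)"
  have F0: "0 \<le> F" using F[of \<tau>] tau norm_ge_zero[of "f \<tau>"] by (smt (verit) greaterThanAtMost_iff)
  have G0: "0 \<le> G" using F0 \<delta> by (simp add: G_def)
  let ?\<kappa> = "memory_weight (\<rho> 1) \<tau>"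
  have \<kappa>: "0 < ?\<kappa>" using adm tau by (intro memory_weight_pos) (auto simp: admissible_coefficients_def)
  have phi: "L2_set \<phi> {..<N} \<le> norm (u 0)" unfolding \<phi>_def by (intro bessel_inequality v) auto
  have tri: "L2_set (\<lambda>k. a k + b k) I \<le> L2_set a I + L2_set b I" for a b and I :: "nat set"
    by (rule L2_set_triangle_ineq)
  have gG: "(\<Sum>k<N. (g k t)\<^sup>2) \<le> G\<^sup>2" if t: "t \<in> {0<..\<tau>}" for t
  proof -
    have "L2_set (\<lambda>k. - \<phi> k * r k t) {..<N} = L2_set (\<lambda>k. \<bar>- \<phi> k * r k t\<bar>) {..<N}" by (rule L2_set_abs[symmetric])
    also have "\<dots> \<le> L2_set (\<lambda>k. \<delta> * \<bar>\<phi> k\<bar>) {..<N}"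
      using res[OF t] by (intro L2_set_mono) (auto simp: abs_mult mult.commute[of \<delta>] intro!: mult_left_mono)
    also have "\<dots> = \<delta> * L2_set \<phi> {..<N}"
      using \<delta> by (simp add: L2_set_abs flip: L2_set_right_distrib)
    also have "\<dots> \<le> \<delta> * norm (u 0)" using \<delta> phi by (intro mult_left_mono) auto
    finally have 1: "L2_set (\<lambda>k. - \<phi> k * r k t) {..<N} \<le> \<delta> * norm (u 0)" .
    have 2: "L2_set (\<lambda>k. inner (f t) (v k)) {..<N} \<le> F"
      using bessel_inequality[OF v, of "{..<N}" "f t"] F[OF t] by simp
    have "L2_set (\<lambda>k. g k t) {..<N} \<le> G"
      unfolding g_def G_def using tri[of "\<lambda>k. inner (f t) (v k)" "\<lambda>k. - \<phi> k * r k t" "{..<N}"] 1 2 by linarith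
    then show ?thesis using power_mono[of "L2_set (\<lambda>k. g k t) {..<N}" G 2]
      by (simp add: L2_set_def sum_nonneg)
  qed
  have "(\<Sum>k<N. (w k \<tau>)\<^sup>2) \<le> (G / l)\<^sup>2"
  proof (rule forced_system_bound[OF adm, where g = g and lam = lam and \<tau> = \<tau>])
    show "continuous_on {0..\<tau>} (w k)" for k
      unfolding w_def by (intro continuous_intros cont cE)
    show "w k 0 = 0" for k by (simp add: w_def \<phi>_def E0)
    show "has_multi_caputo M \<rho> q (w k) t (g k t - lam k * w k t)" if t: "t \<in> {0<..\<tau>}" for k t
    proof -
      have "has_multi_caputo M \<rho> q (w k) t
        ((inner (f t) (v k) - lam k * inner (u t) (v k)) + - \<phi> k * (r k t - lam k * E k t))"
        unfolding w_def by (intro has_multi_caputo_add has_multi_caputo_cmult eq eqE t)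
      also have "(inner (f t) (v k) - lam k * inner (u t) (v k)) + - \<phi> k * (r k t - lam k * E k t)
        = g k t - lam k * w k t" by (simp add: g_def w_def algebra_simps)
      finally show ?thesis .
    qed
  qed (use l gG tau in auto)
  then have w: "L2_set (\<lambda>k. w k \<tau>) {..<N} \<le> G / l"
    using G0 l by (auto simp: L2_set_def intro!: real_le_lsqrt sum_nonneg)
  have "L2_set (\<lambda>k. \<phi> k * E k \<tau>) {..<N} = L2_set (\<lambda>k. inner (u \<tau>) (v k) + - w k \<tau>) {..<N}"
    by (simp add: w_def)
  also have "\<dots> \<le> L2_set (\<lambda>k. inner (u \<tau>) (v k)) {..<N} + L2_set (\<lambda>k. - w k \<tau>) {..<N}" by (rule tri)
  also have "L2_set (\<lambda>k. - w k \<tau>) {..<N} = L2_set (\<lambda>k. w k \<tau>) {..<N}" by (simp add: L2_set_def)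
  finally have phiE: "L2_set (\<lambda>k. \<phi> k * E k \<tau>) {..<N} \<le> norm (u \<tau>) + G / l"
    using w bessel_inequality[OF v, of "{..<N}" "u \<tau>"] by simp
  have "L2_set (\<lambda>k. ?\<kappa> / (?\<kappa> + lam k) * \<phi> k) {..<N} = L2_set (\<lambda>k. \<bar>?\<kappa> / (?\<kappa> + lam k) * \<phi> k\<bar>) {..<N}"
    by (rule L2_set_abs[symmetric])
  also have "\<dots> \<le> L2_set (\<lambda>k. \<bar>\<phi> k * E k \<tau>\<bar> + \<delta> / l * \<bar>\<phi> k\<bar>) {..<N}"
  proof (rule L2_set_mono)
    fix k
    have "(?\<kappa> - \<delta>) / (?\<kappa> + lam k) \<le> E k \<tau>"
      using tau by (intro relaxation_lower_bound[OF adm cE E0 eqE res lam]) auto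
    then have "?\<kappa> / (?\<kappa> + lam k) \<le> E k \<tau> + \<delta> / (?\<kappa> + lam k)" by (simp add: diff_divide_distrib)
    also have "\<delta> / (?\<kappa> + lam k) \<le> \<delta> / l"
      using \<delta> l(1) l(2)[of k] \<kappa> by (intro divide_left_mono) auto
    finally have "?\<kappa> / (?\<kappa> + lam k) \<le> \<bar>E k \<tau>\<bar> + \<delta> / l" by linarith
    then have "?\<kappa> / (?\<kappa> + lam k) * \<bar>\<phi> k\<bar> \<le> (\<bar>E k \<tau>\<bar> + \<delta> / l) * \<bar>\<phi> k\<bar>" by (intro mult_right_mono) auto
    moreover have "\<bar>?\<kappa> / (?\<kappa> + lam k)\<bar> = ?\<kappa> / (?\<kappa> + lam k)" using \<kappa> lam[of k] by simp
    moreover have "(\<bar>E k \<tau>\<bar> + \<delta> / l) * \<bar>\<phi> k\<bar> = \<bar>\<phi> k * E k \<tau>\<bar> + \<delta> / l * \<bar>\<phi> k\<bar>"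
      by (simp add: abs_mult distrib_right)
    ultimately show "\<bar>?\<kappa> / (?\<kappa> + lam k) * \<phi> k\<bar> \<le> \<bar>\<phi> k * E k \<tau>\<bar> + \<delta> / l * \<bar>\<phi> k\<bar>"
      by (simp only: abs_mult)
  qed simp
  also have "\<dots> \<le> L2_set (\<lambda>k. \<bar>\<phi> k * E k \<tau>\<bar>) {..<N} + L2_set (\<lambda>k. \<delta> / l * \<bar>\<phi> k\<bar>) {..<N}" by (rule tri)
  also have "L2_set (\<lambda>k. \<delta> / l * \<bar>\<phi> k\<bar>) {..<N} = \<delta> / l * L2_set \<phi> {..<N}"
    using L2_set_right_distrib[of "\<delta> / l" "\<lambda>k. \<bar>\<phi> k\<bar>" "{..<N}"] \<delta> l by (simp add: L2_set_abs)
  also have "\<delta> / l * L2_set \<phi> {..<N} \<le> \<delta> / l * norm (u 0)" using \<delta> l phi by (intro mult_left_mono) auto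
  also have "L2_set (\<lambda>k. \<bar>\<phi> k * E k \<tau>\<bar>) {..<N} \<le> norm (u \<tau>) + G / l" using phiE by (simp only: L2_set_abs)
  finally have "L2_set (\<lambda>k. ?\<kappa> / (?\<kappa> + lam k) * \<phi> k) {..<N} \<le> norm (u \<tau>) + F / l + 2 * (\<delta> * norm (u 0) / l)"
    by (simp add: G_def add_divide_distrib)
  also have "2 * (\<delta> * norm (u 0) / l) = e * (norm (u 0) / (norm (u 0) + 1))"
  proof -
    have "2 * (e * l / (2 * m) * x / l) = e * (x / m)" if "0 < m" for m x :: real
      using l(1) that by (simp add: field_simps)
    then show ?thesis unfolding \<delta>_def using n0 by blast
  qed
  also have "\<dots> \<le> e * 1" using e n0 by (intro mult_left_mono) auto
  finally show "L2_set (\<lambda>k. ?\<kappa> / (?\<kappa> + lam k) * inner (u 0) (v k)) {..<N} \<le> norm (u \<tau>) + F / l + e"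
    by (simp add: \<phi>_def)
qed

text \<open>Each \<open>v k\<close> lies in the domain of the adjoint, which acts on it as multiplication by \<open>lam k\<close>.\<close>

lemma modal_equation:
  assumes sa: "self_adjoint D A" and es: "eigensystem D A v lam"
    and sol: "backward_solution D A M \<rho> q T f \<Phi> u" and t: "t \<in> {0<..<T}"
  shows "has_multi_caputo M \<rho> q (\<lambda>s. inner (u s) (v k)) t (inner (f t) (v k) - lam k * inner (u t) (v k))"
proof -
  have uD: "u t \<in> D" and ex: "\<And>j. j \<in> {1..M} \<Longrightarrow> caputo_exists (\<rho> j) u t"
    and eq: "(\<Sum>j=1..M. q j *\<^sub>R caputo (\<rho> j) u t) + A (u t) = f t"
    using sol t by (auto simp: backward_solution_def)
  have vD: "v k \<in> D" and Av: "A (v k) = lam k *\<^sub>R v k" using es by (auto simp: eigensystem_def)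
  have "(v k, A (v k)) \<in> adjoint_graph D A"
    using sa vD by (auto simp: self_adjoint_def operator_graph_def)
  then have Au: "inner (A (u t)) (v k) = lam k * inner (u t) (v k)"
    using uD by (simp add: adjoint_graph_def Av)
  have "has_multi_caputo M \<rho> q u t (\<Sum>j=1..M. q j *\<^sub>R caputo (\<rho> j) u t)"
    using ex by (intro has_multi_caputoI) (auto simp: has_caputo_def)
  then have "has_multi_caputo M \<rho> q u t (f t - A (u t))"
    using eq by (metis add_diff_cancel_right')
  from has_multi_caputo_inner[OF this, of "v k"] show ?thesis
    by (simp add: inner_diff_left Au)
qed

theorem theorem4p4:
  fixes D :: "'h::{real_inner, banach, second_countable_topology} set"
    and A :: "'h \<Rightarrow> 'h" and v :: "nat \<Rightarrow> 'h" and lam :: "nat \<Rightarrow> real"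
    and T \<epsilon> \<rho>\<^sub>1 :: real
  assumes "self_adjoint D A" and "positive_operator D A" and "has_compact_inverse D A"
    and "eigensystem D A v lam"
    and "0 < T" and "0 < \<epsilon>"
  shows "\<exists>C>0. \<forall>M \<rho> q. admissible_coefficients M \<rho> q \<and> \<rho> 1 = \<rho>\<^sub>1 \<longrightarrow>
           (\<forall>f \<Phi> u B\<^sub>0. 0 < B\<^sub>0 \<and> continuous_on {0..T} f \<and>
              backward_solution D A M \<rho> q T f \<Phi> u \<and>
              u 0 \<in> power_domain v lam \<epsilon> \<and> (power_norm v lam \<epsilon> (u 0))\<^sup>2 \<le> B\<^sub>0\<^sup>2 \<longrightarrow>
              norm (u 0) \<le> C * (norm \<Phi> + (SUP t\<in>{0..T}. norm (f t))) powr (\<epsilon> / (1 + \<epsilon>))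
                              * B\<^sub>0 powr (1 / (1 + \<epsilon>)))"
proof (cases "0 < \<rho>\<^sub>1 \<and> \<rho>\<^sub>1 < 1")
  case False
  \<comment> \<open>No admissible coefficients have this leading order.\<close>
  have "\<not> (admissible_coefficients M \<rho> q \<and> \<rho> 1 = \<rho>\<^sub>1)" for M \<rho> q
    using False admissible_order_range(1,3)[of M \<rho> q 1] by (auto simp: admissible_coefficients_def)
  then show ?thesis by (intro exI[of _ 1]) auto
next
  case True
  have v: "inner (v i) (v j) = (if i = j then 1 else 0)" for i j
    using assms(4) by (simp add: eigensystem_def)
  have dense: "closure (span (range v)) = UNIV" and l: "0 < lam 0" and mono: "incseq lam"
    using assms(4) by (simp_all add: eigensystem_def)
  have l0: "lam 0 \<le> lam k" for k using mono by (simp add: incseq_def)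
  have lam: "0 < lam k" for k using l l0[of k] by linarith
  define \<kappa> where "\<kappa> = memory_weight \<rho>\<^sub>1 T"
  have \<kappa>: "0 < \<kappa>" unfolding \<kappa>_def using True assms(5) by (intro memory_weight_pos) auto
  \<comment> \<open>The number \<open>c\<close> is the best constant with \<open>c / lam k \<le> \<kappa> / (\<kappa> + lam k)\<close> for all \<open>k\<close>; it is attained at \<open>k = 0\<close>.\<close>
  define c where "c = \<kappa> * lam 0 / (\<kappa> + lam 0)"
  have c: "0 < c" using \<kappa> l by (simp add: c_def)
  define K where "K = (1 + 1 / lam 0) / c"
  have K: "0 < K" unfolding K_def using l c by (intro divide_pos_pos add_pos_pos) auto
  let ?\<alpha> = "\<epsilon> / (1 + \<epsilon>)" and ?\<beta> = "1 / (1 + \<epsilon>)"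
  show ?thesis
  proof (intro exI[of _ "K powr ?\<alpha>"] conjI allI impI; (elim conjE)?)
    show "0 < K powr ?\<alpha>" using K by simp
  next
    fix M \<rho> q f \<Phi> u B\<^sub>0
    assume adm: "admissible_coefficients M \<rho> q" and \<rho>1: "\<rho> 1 = \<rho>\<^sub>1" and B0: "0 < B\<^sub>0"
      and contf: "continuous_on {0..T} f" and sol: "backward_solution D A M \<rho> q T f \<Phi> u"
      and dom: "u 0 \<in> power_domain v lam \<epsilon>" and pn: "(power_norm v lam \<epsilon> (u 0))\<^sup>2 \<le> B\<^sub>0\<^sup>2"
    define F where "F = (SUP t\<in>{0..T}. norm (f t))"
    have "bdd_above ((\<lambda>t. norm (f t)) ` {0..T})"
      using contf by (intro bounded_imp_bdd_above compact_imp_bounded compact_continuous_image continuous_intros) auto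
    then have fF: "norm (f t) \<le> F" if "t \<in> {0..T}" for t
      unfolding F_def using that by (intro cSUP_upper) auto
    have F0: "0 \<le> F" using fF[of 0] assms(5) norm_ge_zero[of "f 0"] by (smt (verit) atLeastAtMost_iff)
    have contu: "continuous_on {0..T} u" and uT: "u T = \<Phi>" using sol by (auto simp: backward_solution_def)
    define \<phi> where "\<phi> k = inner (u 0) (v k)" for k
    have weak: "c * L2_set (\<lambda>k. \<phi> k / lam k) {..<N} \<le> norm (u \<tau>) + F / lam 0" if \<tau>: "\<tau> \<in> {0<..<T}" for N \<tau>
    proof -
      let ?\<kappa> = "memory_weight (\<rho> 1) \<tau>"
      have \<kappa>\<tau>: "\<kappa> \<le> ?\<kappa>" unfolding \<kappa>_def \<rho>1 using True \<tau> by (intro memory_weight_antimono) auto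
      have "c * L2_set (\<lambda>k. \<phi> k / lam k) {..<N} = L2_set (\<lambda>k. \<bar>c * (\<phi> k / lam k)\<bar>) {..<N}"
        using c by (simp only: L2_set_abs L2_set_right_distrib less_imp_le)
      also have "\<dots> \<le> L2_set (\<lambda>k. \<bar>?\<kappa> / (?\<kappa> + lam k) * \<phi> k\<bar>) {..<N}"
      proof (rule L2_set_mono)
        fix k
        have "\<kappa> * (\<kappa> * lam 0) \<le> \<kappa> * (\<kappa> * lam k)" using \<kappa> l0[of k] by simp
        then have "\<kappa> * lam 0 * (\<kappa> + lam k) \<le> \<kappa> * ((\<kappa> + lam 0) * lam k)" by (simp add: algebra_simps)
        then have "\<kappa> * lam 0 / ((\<kappa> + lam 0) * lam k) \<le> \<kappa> / (\<kappa> + lam k)"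
          using \<kappa> l lam[of k] by (simp only: pos_divide_le_eq pos_le_divide_eq add_pos_pos mult_pos_pos
            times_divide_eq_left)
        then have "c / lam k \<le> \<kappa> / (\<kappa> + lam k)" by (simp only: c_def divide_divide_eq_left)
        also have "\<dots> \<le> ?\<kappa> / (?\<kappa> + lam k)"
          using \<kappa>\<tau> \<kappa> lam[of k] by (simp add: field_simps)
        finally have "c / lam k * \<bar>\<phi> k\<bar> \<le> ?\<kappa> / (?\<kappa> + lam k) * \<bar>\<phi> k\<bar>" by (intro mult_right_mono) auto
        then show "\<bar>c * (\<phi> k / lam k)\<bar> \<le> \<bar>?\<kappa> / (?\<kappa> + lam k) * \<phi> k\<bar>"
          using c lam[of k] \<kappa> \<kappa>\<tau> by (simp add: abs_mult)
      qed simp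
      also have "\<dots> = L2_set (\<lambda>k. ?\<kappa> / (?\<kappa> + lam k) * \<phi> k) {..<N}" by (rule L2_set_abs)
      also have "\<dots> \<le> norm (u \<tau>) + F / lam 0"
        unfolding \<phi>_def
      proof (rule initial_value_weak_bound[OF adm v l l0])
        show "continuous_on {0..\<tau>} u" using \<tau> by (intro continuous_on_subset[OF contu]) auto
      next
        fix k t assume "t \<in> {0<..\<tau>}"
        then show "has_multi_caputo M \<rho> q (\<lambda>s. inner (u s) (v k)) t
            (inner (f t) (v k) - lam k * inner (u t) (v k))"
          using \<tau> by (intro modal_equation[OF assms(1,4) sol]) auto
      qed (use \<tau> fF in auto)
      finally show ?thesis .
    qed
    \<comment> \<open>The equation says nothing at \<open>T\<close>; the final value enters by continuity of \<open>u\<close>.\<close>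
    have weakT: "L2_set (\<lambda>k. \<phi> k / lam k) {..<N} \<le> K * (norm \<Phi> + F)" for N
    proof -
      have "(u \<longlongrightarrow> \<Phi>) (at_left T)" using continuous_on_Icc_at_leftD[OF contu assms(5)] uT by simp
      then have "((\<lambda>\<tau>. norm (u \<tau>) + F / lam 0) \<longlongrightarrow> norm \<Phi> + F / lam 0) (at_left T)"
        by (intro tendsto_intros)
      moreover have "\<forall>\<^sub>F \<tau> in at_left T. c * L2_set (\<lambda>k. \<phi> k / lam k) {..<N} \<le> norm (u \<tau>) + F / lam 0"
        using eventually_at_left_real[OF assms(5)] by eventually_elim (rule weak)
      ultimately have "c * L2_set (\<lambda>k. \<phi> k / lam k) {..<N} \<le> norm \<Phi> + F / lam 0"
        by (intro tendsto_lowerbound) auto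
      also have "\<dots> \<le> (1 + 1 / lam 0) * (norm \<Phi> + F)"
        using l F0 by (simp add: field_simps)
      finally show ?thesis using c by (simp add: K_def field_simps)
    qed
    have strong: "(\<Sum>k<N. lam k powr (2 * \<epsilon>) * (\<phi> k)\<^sup>2) \<le> B\<^sub>0\<^sup>2" for N
    proof -
      have sq: "(lam k powr \<epsilon> * \<phi> k)\<^sup>2 = lam k powr (2 * \<epsilon>) * (\<phi> k)\<^sup>2" for k
        using powr_add[of "lam k" \<epsilon> \<epsilon>] by (simp add: power_mult_distrib power2_eq_square)
      have "summable (\<lambda>k. (lam k powr \<epsilon> * \<phi> k)\<^sup>2)"
        using dom unfolding sq by (simp add: power_domain_def \<phi>_def)
      from orthonormal_series_norm[OF v this, of N]
      have "(\<Sum>k<N. (lam k powr \<epsilon> * \<phi> k)\<^sup>2) \<le> (power_norm v lam \<epsilon> (u 0))\<^sup>2"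
        by (simp add: power_norm_def operator_power_def \<phi>_def)
      then show ?thesis using pn unfolding sq by linarith
    qed
    have "(\<Sum>k<N. (\<phi> k)\<^sup>2) \<le> (K * (norm \<Phi> + F)) powr (2 * ?\<alpha>) * B\<^sub>0 powr (2 * ?\<beta>)" for N
    proof -
      have X0: "0 \<le> K * (norm \<Phi> + F)" using K F0 by simp
      have "(\<Sum>k<N. (\<phi> k / lam k)\<^sup>2) = (L2_set (\<lambda>k. \<phi> k / lam k) {..<N})\<^sup>2"
        by (simp add: L2_set_def sum_nonneg)
      also have "\<dots> \<le> (K * (norm \<Phi> + F))\<^sup>2" by (intro power_mono weakT) simp
      finally have 1: "(\<Sum>k<N. (\<phi> k / lam k)\<^sup>2) powr ?\<alpha> \<le> ((K * (norm \<Phi> + F))\<^sup>2) powr ?\<alpha>"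
        using assms(6) by (intro powr_mono2) (auto intro: sum_nonneg)
      have 2: "(\<Sum>k<N. lam k powr (2 * \<epsilon>) * (\<phi> k)\<^sup>2) powr ?\<beta> \<le> (B\<^sub>0\<^sup>2) powr ?\<beta>"
        using assms(6) strong by (intro powr_mono2) (auto intro: sum_nonneg)
      have pw: "(x\<^sup>2) powr a = x powr (2 * a)" if "0 \<le> x" for x a :: real
        using that by (cases "x = 0") (auto simp: powr_powr simp flip: powr_numeral)
      have "(\<Sum>k<N. (\<phi> k)\<^sup>2) \<le> (\<Sum>k<N. (\<phi> k / lam k)\<^sup>2) powr ?\<alpha>
           * (\<Sum>k<N. lam k powr (2 * \<epsilon>) * (\<phi> k)\<^sup>2) powr ?\<beta>"
        using lam assms(6) by (intro power_scale_interpolation) auto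
      also have "\<dots> \<le> ((K * (norm \<Phi> + F))\<^sup>2) powr ?\<alpha> * (B\<^sub>0\<^sup>2) powr ?\<beta>"
        by (intro mult_mono 1 2) auto
      finally show ?thesis using B0 by (simp only: pw[OF X0] pw[OF less_imp_le[OF B0]])
    qed
    then have "(norm (u 0))\<^sup>2 \<le> (K * (norm \<Phi> + F)) powr (2 * ?\<alpha>) * B\<^sub>0 powr (2 * ?\<beta>)"
      unfolding \<phi>_def by (rule norm_le_of_coefficients[OF v dense])
    also have "\<dots> = ((K * (norm \<Phi> + F)) powr ?\<alpha> * B\<^sub>0 powr ?\<beta>)\<^sup>2"
      by (simp only: mult_2 powr_add) (simp add: power2_eq_square)
    finally have "norm (u 0) \<le> (K * (norm \<Phi> + F)) powr ?\<alpha> * B\<^sub>0 powr ?\<beta>"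
      by (rule power2_le_imp_le) simp
    also have "(K * (norm \<Phi> + F)) powr ?\<alpha> = K powr ?\<alpha> * (norm \<Phi> + F) powr ?\<alpha>"
      using K F0 by (simp add: powr_mult)
    finally show "norm (u 0) \<le> K powr ?\<alpha> * (norm \<Phi> + (SUP t\<in>{0..T}. norm (f t))) powr ?\<alpha> * B\<^sub>0 powr ?\<beta>"
      by (simp add: F_def)
  qed
qed

end
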